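(* Let a measure $\nu$ on $\mathbb{R}^\times$ satisfy $\int_{\mathbb{R}^\times}d\nu(t)=1$ and $\int_{\mathbb{R}^\times}t\,d\nu(t)=1$, and let $\nu=\nu^c+\nu^d$ be its decomposition into continuous and discrete parts. Then the closure in $\mathrm{Gms}(M)$ of the double coset $S[\nu^c,0,0,\dots;\nu^d]$ contains all double cosets $S[\nu_1,\nu_2,\nu_3,\dots;\nu_\infty^c+\nu^d]$ with $\nu_1+\nu_2+\dots+\nu_\infty^c=\nu^c$.
   Context: $\mathbb{R}^\times$ is the set of positive reals, with coordinate $t$; "continuous" for measures means non-atomic. $(M,\mu)$ is a Lebesgue space with a continuous probability measure. $\mathrm{Gms}(M)$ is the group of all invertible measurable transformations $g$ of $M$ (identified if equal a.e.) leaving $\mu$ quasi-invariant (images and preimages of null sets are null); $\mathrm{Ams}(M)$ is its subgroup of measure-preserving transformations. $g'$ denotes the Radon--Nikodym derivative, $\mu(gA)=\int_A g'\,d\mu$. For measurable $A,B\subset M$, $\kappa[g;A,B]$ is the measure on $\mathbb{R}^\times$ given by $\kappa[g;A,B](E)=\mu\{x\in A\cap g^{-1}(B): g'(x)\in E\}$; $t\kappa$ denotes the measure with density $t$ with respect to $\kappa$. Topology on $\mathrm{Gms}(M)$: the coarsest topology such that for all measurable $A,B$ the maps $g\mapsto\kappa[g;A,B]$ and $g\mapsto t\kappa[g;A,B]$ are continuous for weak convergence of finite measures on $\mathbb{R}^\times$ (so $g_j\to g$ iff both sequences of measures converge weakly for all $A,B$). Let $\mathcal{L}:=\mathbb{R}^\times_1\sqcup\mathbb{R}^\times_2\sqcup\dots\sqcup(\mathbb{R}^\times_\infty\times[0,1])$,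 where $\mathbb{R}^\times_j$ and $\mathbb{R}^\times_\infty$ are copies of $\mathbb{R}^\times$. Let $\nu_1,\nu_2,\dots;\nu_\infty$ be measures on $\mathbb{R}^\times$ such that $\nu_1,\nu_2,\dots$ are continuous ($\nu_\infty$ may have atoms), $\nu_1\ge\nu_2\ge\dots$, and the total $\nu_1+\nu_2+\dots+\nu_\infty$ has $\int d\nu=\int t\,d\nu=1$. $\mathcal{L}[\nu_1,\nu_2,\dots;\nu_\infty]$ is $\mathcal{L}$ with the measure $\nu_j$ on $\mathbb{R}^\times_j$ and $\nu_\infty\times dx$ on $\mathbb{R}^\times_\infty\times[0,1]$ ($dx$ = Lebesgue measure), and $\mathcal{L}_*[\nu_1,\nu_2,\dots;\nu_\infty]$ is $\mathcal{L}$ with the same measure multiplied by $t$. $S[\nu_1,\nu_2,\dots;\nu_\infty]\subset\mathrm{Gms}(M)$ is the double coset of $\mathrm{Ams}(M)$ consisting of all $g=b^{-1}\circ\mathrm{id}\circ a$, where $a:M\to\mathcal{L}[\nu_1,\nu_2,\dots;\nu_\infty]$ and $b:M\to\mathcal{L}_*[\nu_1,\nu_2,\dots;\nu_\infty]$ are measure-preserving bijections (mod $0$) and $\mathrm{id}$ is the identity map of $\mathcal{L}$. In the claim, the symbol $S[\nu_1,\nu_2,\dots;\nu_\infty^c+\nu^d]$ presupposes that the family $(\nu_1,\nu_2,\dots;\nu_\infty^c+\nu^d)$ satisfies these conditions. *)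

theory Defs
  imports "HOL-Probability.Probability"
begin

section \<open>Operations on measures\<close>

definition nonatomic :: "'a measure \<Rightarrow> bool" where
  "nonatomic M \<longleftrightarrow> (\<forall>A\<in>sets M. 0 < emeasure M A \<longrightarrow>
     (\<exists>B\<in>sets M. B \<subseteq> A \<and> 0 < emeasure M B \<and> emeasure M B < emeasure M A))"

definition discrete_measure :: "'a measure \<Rightarrow> bool" where
  "discrete_measure M \<longleftrightarrow>
     (\<exists>C. countable C \<and> C \<in> sets M \<and> emeasure M (space M - C) = 0)"

text \<open>Only meaningful for measures on the same \<open>\<sigma>\<close>-algebra.\<close>

definition add_measure :: "'a measure \<Rightarrow> 'a measure \<Rightarrow> 'a measure" where
  "add_measure M N = measure_of (space M) (sets M) (\<lambda>E. emeasure M E + emeasure N E)"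

definition disjoint_sum :: "'a measure \<Rightarrow> 'b measure \<Rightarrow> ('a + 'b) measure" where
  "disjoint_sum M N = measure_of (space M <+> space N)
     {X. X \<subseteq> space M <+> space N \<and> Inl -` X \<in> sets M \<and> Inr -` X \<in> sets N}
     (\<lambda>X. emeasure M (Inl -` X) + emeasure N (Inr -` X))"

definition disjoint_family_sum :: "(nat \<Rightarrow> 'a measure) \<Rightarrow> (nat \<times> 'a) measure" where
  "disjoint_family_sum M = measure_of (SIGMA j:UNIV. space (M j))
     {X. X \<subseteq> (SIGMA j:UNIV. space (M j)) \<and> (\<forall>j. Pair j -` X \<in> sets (M j))}
     (\<lambda>X. \<Sum>j. emeasure (M j) (Pair j -` X))"

section \<open>Isomorphisms modulo null sets and Lebesgue spaces\<close>

text \<open>A map that is invertible mod 0 is given together with an inverse mod 0. Both are total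
  functions whose values on a null set are irrelevant. For this reason the image of a set under
  \<open>f\<close> is always expressed as its preimage under the inverse \<open>f'\<close>: the pointwise image of a null
  set under an unfortunate representative can be arbitrary.\<close>

definition inverse_mod0 :: "'a measure \<Rightarrow> 'b measure \<Rightarrow> ('a \<Rightarrow> 'b) \<Rightarrow> ('b \<Rightarrow> 'a) \<Rightarrow> bool" where
  "inverse_mod0 M N f f' \<longleftrightarrow> f \<in> measurable M N \<and> f' \<in> measurable N M \<and>
     (AE x in M. f' (f x) = x) \<and> (AE y in N. f (f' y) = y)"

definition measure_preserving_iso ::
    "'a measure \<Rightarrow> 'b measure \<Rightarrow> ('a \<Rightarrow> 'b) \<Rightarrow> ('b \<Rightarrow> 'a) \<Rightarrow> bool" where
  "measure_preserving_iso M N f f' \<longleftrightarrow> inverse_mod0 M N f f' \<and>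
     (\<forall>A\<in>sets N. emeasure M (f -` A \<inter> space M) = emeasure N A)"

definition nonsingular_iso ::
    "'a measure \<Rightarrow> 'b measure \<Rightarrow> ('a \<Rightarrow> 'b) \<Rightarrow> ('b \<Rightarrow> 'a) \<Rightarrow> bool" where
  "nonsingular_iso M N f f' \<longleftrightarrow> inverse_mod0 M N f f' \<and>
     (\<forall>A\<in>null_sets N. f -` A \<inter> space M \<in> null_sets M) \<and>
     (\<forall>A\<in>null_sets M. f' -` A \<inter> space N \<in> null_sets N)"

text \<open>Rokhlin's Lebesgue (probability) spaces: complete, and isomorphic mod 0 to an interval
  with Lebesgue measure together with at most countably many atoms, of masses \<open>p n\<close>.\<close>

definition lebesgue_space :: "'a measure \<Rightarrow> bool" where
  "lebesgue_space M \<longleftrightarrow> prob_space M \<and> complete_measure M \<and>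
     (\<exists>(c::real) (p::nat \<Rightarrow> ennreal) f f'. 0 \<le> c \<and>
        measure_preserving_iso M
          (disjoint_sum (lebesgue_on {0..c}) (density (count_space UNIV) p)) f f')"

section \<open>The group \<open>Gms\<close> and its topology\<close>

definition gms_maps :: "'a measure \<Rightarrow> ('a \<Rightarrow> 'a) set" where
  "gms_maps M = {g. \<exists>g'. nonsingular_iso M M g g'}"

definition gms_rel :: "'a measure \<Rightarrow> (('a \<Rightarrow> 'a) \<times> ('a \<Rightarrow> 'a)) set" where
  "gms_rel M = {(g, h). g \<in> gms_maps M \<and> h \<in> gms_maps M \<and> (AE x in M. g x = h x)}"

definition Gms :: "'a measure \<Rightarrow> ('a \<Rightarrow> 'a) set set" where
  "Gms M = gms_maps M // gms_rel M"

text \<open>The measure \<open>A \<mapsto> \<mu>(gA)\<close> is the image of \<open>\<mu>\<close> under the inverse of \<open>g\<close>.\<close>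

definition gms_deriv :: "'a measure \<Rightarrow> ('a \<Rightarrow> 'a) \<Rightarrow> 'a \<Rightarrow> real" where
  "gms_deriv M g x =
     enn2real (RN_deriv M (distr M M (SOME g'. nonsingular_iso M M g g')) x)"

definition Rpos :: "real measure" where
  "Rpos = restrict_space borel {0<..}"

definition kappa_map :: "'a measure \<Rightarrow> ('a \<Rightarrow> 'a) \<Rightarrow> 'a set \<Rightarrow> 'a set \<Rightarrow> real measure" where
  "kappa_map M g A B = measure_of (space Rpos) (sets Rpos)
     (\<lambda>E. emeasure M {x \<in> A. g x \<in> B \<and> gms_deriv M g x \<in> E})"

text \<open>Representatives that agree almost everywhere yield the same measure.\<close>

definition kappa :: "'a measure \<Rightarrow> ('a \<Rightarrow> 'a) set \<Rightarrow> 'a set \<Rightarrow> 'a set \<Rightarrow> real measure" where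
  "kappa M c A B = kappa_map M (SOME g. g \<in> c) A B"

definition times_t :: "real measure \<Rightarrow> real measure" where
  "times_t N = density N (\<lambda>t. ennreal t)"

definition finite_measures_Rpos :: "real measure set" where
  "finite_measures_Rpos = {N. sets N = sets Rpos \<and> finite_measure N}"

definition weak_topology_Rpos :: "real measure topology" where
  "weak_topology_Rpos = topology_generated_by
     {{N \<in> finite_measures_Rpos. (\<integral>t. \<phi> t \<partial>N) \<in> V} | (\<phi> :: real \<Rightarrow> real) V.
        continuous_on {0<..} \<phi> \<and> bounded (\<phi> ` {0<..}) \<and> open V}"

definition Gms_topology :: "'a measure \<Rightarrow> ('a \<Rightarrow> 'a) set topology" where
  "Gms_topology M = topology_generated_by
     ({{c \<in> Gms M. kappa M c A B \<in> U} | A B U.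
         A \<in> sets M \<and> B \<in> sets M \<and> openin weak_topology_Rpos U} \<union>
      {{c \<in> Gms M. times_t (kappa M c A B) \<in> U} | A B U.
         A \<in> sets M \<and> B \<in> sets M \<and> openin weak_topology_Rpos U})"

section \<open>The spaces \<open>\<L>\<close>, \<open>\<L>\<^sub>*\<close> and the double cosets\<close>

text \<open>A sequence \<open>\<nu> 0, \<nu> 1, \<dots>\<close> stands for \<open>\<nu>\<^sub>1, \<nu>\<^sub>2, \<dots>\<close>.\<close>

definition total_measure :: "(nat \<Rightarrow> real measure) \<Rightarrow> real measure \<Rightarrow> real measure" where
  "total_measure \<nu> \<nu>_inf = measure_of (space Rpos) (sets Rpos)
     (\<lambda>E. (\<Sum>j. emeasure (\<nu> j) E) + emeasure \<nu>_inf E)"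

definition admissible :: "(nat \<Rightarrow> real measure) \<Rightarrow> real measure \<Rightarrow> bool" where
  "admissible \<nu> \<nu>_inf \<longleftrightarrow>
     (\<forall>j. sets (\<nu> j) = sets Rpos \<and> nonatomic (\<nu> j)) \<and> sets \<nu>_inf = sets Rpos \<and>
     (\<forall>j. \<forall>E\<in>sets Rpos. emeasure (\<nu> (Suc j)) E \<le> emeasure (\<nu> j) E) \<and>
     emeasure (total_measure \<nu> \<nu>_inf) (space Rpos) = 1 \<and>
     (\<integral>\<^sup>+t. ennreal t \<partial>(total_measure \<nu> \<nu>_inf)) = 1"

text \<open>Completed, since Lebesgue spaces are complete.\<close>

definition L_space ::
    "(nat \<Rightarrow> real measure) \<Rightarrow> real measure \<Rightarrow> (nat \<times> real + real \<times> real) measure" where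
  "L_space \<nu> \<nu>_inf = completion
     (disjoint_sum (disjoint_family_sum \<nu>) (\<nu>_inf \<Otimes>\<^sub>M restrict_space lborel {0..1}))"

fun t_coord :: "nat \<times> real + real \<times> real \<Rightarrow> real" where
  "t_coord (Inl (j, t)) = t"
| "t_coord (Inr (t, x)) = t"

definition L_star_space ::
    "(nat \<Rightarrow> real measure) \<Rightarrow> real measure \<Rightarrow> (nat \<times> real + real \<times> real) measure" where
  "L_star_space \<nu> \<nu>_inf = density (L_space \<nu> \<nu>_inf) (\<lambda>p. ennreal (t_coord p))"

definition double_coset ::
    "'a measure \<Rightarrow> (nat \<Rightarrow> real measure) \<Rightarrow> real measure \<Rightarrow> ('a \<Rightarrow> 'a) set set" where
  "double_coset M \<nu> \<nu>_inf = {gms_rel M `` {b' \<circ> id \<circ> a} | a a' b b'.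
     measure_preserving_iso M (L_space \<nu> \<nu>_inf) a a' \<and>
     measure_preserving_iso M (L_star_space \<nu> \<nu>_inf) b b'}"

end

theory Submission
  imports Defs
begin

text \<open>The topology of \<open>Gms\<close> tests an element \<open>g\<close> only through the measures \<open>\<kappa>[g;A,B]\<close>, that is,
through the joint behaviour of \<open>x\<close>, \<open>g x\<close> and the derivative \<open>g' x\<close> with respect to finitely many
sets and functions at a time. What survives of a double coset in its closure is therefore very
little: every \<open>g\<close> whose derivative has the law \<open>\<nu>\<close> under \<open>\<mu>\<close> is a limit of elements of
\<open>S[\<nu>\<^sup>c,0,0,\<dots>;\<nu>\<^sup>d]\<close>. An element \<open>b\<^sup>-\<^sup>1 \<circ> a\<close> of \<open>S[\<nu>\<^sub>1,\<nu>\<^sub>2,\<dots>;\<nu>\<^sub>\<infinity>]\<close> has derivative \<open>t (a x)\<close>, whose law is the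
total measure \<open>\<nu>\<^sub>1 + \<nu>\<^sub>2 + \<dots> + \<nu>\<^sub>\<infinity> = \<nu>\<close>, so the theorem follows.

Let \<open>L\<close> and \<open>L\<^sub>*\<close> be the two spaces that belong to \<open>(\<nu>\<^sup>c,0,0,\<dots>;\<nu>\<^sup>d)\<close>, and let \<open>g\<close> be such an element.
Finitely many tests are given, with target sets \<open>B\<^sub>1,\<dots>,B\<^sub>n\<close>. One has to find isomorphisms \<open>a : M \<rightarrow> L\<close>
and \<open>b : M \<rightarrow> L\<^sub>*\<close> such that \<open>h = b\<^sup>-\<^sup>1 \<circ> a\<close> passes the tests together with \<open>g\<close>.

\<^item> Cut \<open>(0,\<infinity>)\<close> into countably many pieces on which \<open>t\<close> and all test functions vary by at most \<open>\<delta>\<close>.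
  Since \<open>g'\<close> and \<open>t\<close> have the same law, \<open>a\<close> can be chosen to carry \<open>{g' \<in> piece}\<close> onto \<open>{t \<in> piece}\<close>.
  Then \<open>h' = t \<circ> a\<close> is uniformly close to \<open>g'\<close>, also after composition with a test function.

\<^item> The sets \<open>B\<^sub>i\<close> generate a finite partition of \<open>M\<close>. For a cell \<open>Y\<close> the masses of \<open>Y\<close> in \<open>M\<close> and of
  \<open>a (g\<^sup>-\<^sup>1 Y)\<close> in \<open>L\<^sub>*\<close> are the integrals of \<open>g'\<close> and of \<open>h'\<close> over \<open>g\<^sup>-\<^sup>1 Y\<close>, hence they differ by at most
  \<open>\<delta>\<close>. So \<open>b\<close> can be chosen to carry \<open>Y\<close> to \<open>a (g\<^sup>-\<^sup>1 Y)\<close> up to an error of order \<open>\<delta>\<close>. This means that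
  \<open>h x\<close> and \<open>g x\<close> lie in the same cell except on a set of small \<open>h'\<mu>\<close>-measure, and this set is also
  small for \<open>\<mu>\<close> because \<open>h'\<close> has the fixed law \<open>\<nu>\<close>, which gives no mass to \<open>0\<close>.

Both choices rest on \<open>iso_matching_indices\<close>: between two atomless Lebesgue spaces with countable
indexed partitions there is an isomorphism that matches the initial unions of cells up to the
unavoidable difference of their masses. It is a monotone rearrangement: the cell number and the
position in the cell are coded in one real number, and distribution functions are composed.
That \<open>L\<close> and \<open>L\<^sub>*\<close> are Lebesgue spaces without atoms is seen from a Borel injection into the line.\<close>

section \<open>Measure-preserving isomorphisms\<close>

lemma mp_iso_comp:
  assumes f: "measure_preserving_iso M N f f'" and g: "measure_preserving_iso N P g g'"
  shows "measure_preserving_iso M P (g \<circ> f) (f' \<circ> g')"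
proof -
  have fm: "f \<in> measurable M N" "f' \<in> measurable N M" "AE x in M. f' (f x) = x" "AE y in N. f (f' y) = y"
    and fe: "\<And>A. A \<in> sets N \<Longrightarrow> emeasure M (f -` A \<inter> space M) = emeasure N A"
    and gm: "g \<in> measurable N P" "g' \<in> measurable P N" "AE x in N. g' (g x) = x" "AE y in P. g (g' y) = y"
    and ge: "\<And>A. A \<in> sets P \<Longrightarrow> emeasure N (g -` A \<inter> space N) = emeasure P A"
    using f g by (auto simp: measure_preserving_iso_def inverse_mod0_def)
  have N: "N = distr M N f" by (rule measure_eqI) (auto simp: emeasure_distr fm fe)
  have ge': "emeasure P (g' -` A \<inter> space P) = emeasure N A" if A: "A \<in> sets N" for A
  proof -
    have "emeasure P (g' -` A \<inter> space P) = emeasure N (g -` (g' -` A \<inter> space P) \<inter> space N)"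
      using A gm by (subst ge) auto
    also have "\<dots> = emeasure N A"
    proof (rule emeasure_eq_AE)
      show "AE x in N. x \<in> g -` (g' -` A \<inter> space P) \<inter> space N \<longleftrightarrow> x \<in> A"
        using gm(3) AE_space by eventually_elim (auto simp: measurable_space[OF gm(1)])
    qed (use gm(1,2) A in auto)
    finally show ?thesis .
  qed
  have N': "N = distr P N g'" by (rule measure_eqI) (auto simp: emeasure_distr gm ge')
  have "AE x in M. g' (g (f x)) = f x" 
    using gm(3) by (subst (asm) N) (rule AE_distrD[OF fm(1)])
  then have 1: "AE x in M. f' (g' (g (f x))) = x" using fm(3) by eventually_elim auto
  have "AE x in P. f (f' (g' x)) = g' x" 
    using fm(4) by (subst (asm) N') (rule AE_distrD[OF gm(2)])
  then have 2: "AE x in P. g (f (f' (g' x))) = x" using gm(4) by eventually_elim auto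
  have "emeasure M ((g \<circ> f) -` A \<inter> space M) = emeasure P A" if A: "A \<in> sets P" for A
  proof -
    have "(g \<circ> f) -` A \<inter> space M = f -` (g -` A \<inter> space N) \<inter> space M"
      using measurable_space[OF fm(1)] by auto
    then show ?thesis using gm A by (simp add: fe ge del: vimage_Int)
  qed
  then show ?thesis using 1 2 fm gm
    unfolding measure_preserving_iso_def inverse_mod0_def
    by (intro conjI ballI) (simp_all add: measurable_comp[OF fm(1) gm(1)] measurable_comp[OF gm(2) fm(2)])
qed

lemma mp_iso_distr:
  assumes "measure_preserving_iso M N f f'" shows "distr M N f = N"
  using assms by (intro measure_eqI) (auto simp: emeasure_distr measure_preserving_iso_def inverse_mod0_def)

lemma mp_iso_sym:
  assumes g: "measure_preserving_iso N P g g'"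
  shows "measure_preserving_iso P N g' g"
proof -
  have gm: "g \<in> measurable N P" "g' \<in> measurable P N" "AE x in N. g' (g x) = x" "AE y in P. g (g' y) = y"
    and ge: "\<And>A. A \<in> sets P \<Longrightarrow> emeasure N (g -` A \<inter> space N) = emeasure P A"
    using g by (auto simp: measure_preserving_iso_def inverse_mod0_def)
  have ge': "emeasure P (g' -` A \<inter> space P) = emeasure N A" if A: "A \<in> sets N" for A
  proof -
    have "emeasure P (g' -` A \<inter> space P) = emeasure N (g -` (g' -` A \<inter> space P) \<inter> space N)"
      using A gm by (subst ge) auto
    also have "\<dots> = emeasure N A"
    proof (rule emeasure_eq_AE)
      show "AE x in N. x \<in> g -` (g' -` A \<inter> space P) \<inter> space N \<longleftrightarrow> x \<in> A"
        using gm(3) AE_space by eventually_elim (auto simp: measurable_space[OF gm(1)])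
    qed (use gm(1,2) A in auto)
    finally show ?thesis .
  qed
  then show ?thesis using gm by (auto simp: measure_preserving_iso_def inverse_mod0_def)
qed

lemma mp_iso_facts:
  assumes g: "measure_preserving_iso N P g g'"
  shows "g \<in> measurable N P" "g' \<in> measurable P N" "AE x in N. g' (g x) = x" "AE y in P. g (g' y) = y"
    "\<And>A. A \<in> sets P \<Longrightarrow> emeasure N (g -` A \<inter> space N) = emeasure P A"
    "\<And>A. A \<in> sets N \<Longrightarrow> emeasure P (g' -` A \<inter> space P) = emeasure N A"
  using g mp_iso_sym[OF g] by (auto simp: measure_preserving_iso_def inverse_mod0_def)

text \<open>Null sets pull back to null sets in both directions, so measurability passes to the completions.
This allows all constructions to be made with Borel spaces.\<close>

lemma mp_iso_completion:
  assumes g: "measure_preserving_iso N P g g'"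
  shows "measure_preserving_iso (completion N) (completion P) g g'"
proof -
  note gm = mp_iso_facts[OF g]
  have d: "distr (completion N) P g = P" "distr (completion P) N g' = N"
    using mp_iso_distr[OF g] mp_iso_distr[OF mp_iso_sym[OF g]] distr_completion[OF gm(1)] distr_completion[OF gm(2)]
    by auto
  have 1: "g \<in> measurable (completion N) (completion P)" 
    by (rule completion.measurable_completion2) (auto simp: d gm intro: measurable_completion)
  have 2: "g' \<in> measurable (completion P) (completion N)" 
    by (rule completion.measurable_completion2) (auto simp: d gm intro: measurable_completion)
  have 3: "distr (completion N) (completion P) g = completion P"
    using completion.completion_distr_eq[where X=g and N=P and M=N] gm(1) d measurable_completion by metis
  show ?thesis unfolding measure_preserving_iso_def inverse_mod0_def
  proof (intro conjI ballI)
    show "AE x in completion N. g' (g x) = x" "AE x in completion P. g (g' x) = x" 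
      using gm by (auto intro: AE_completion)
    fix A assume "A \<in> sets (completion P)"
    then show "emeasure (completion N) (g -` A \<inter> space (completion N)) = emeasure (completion P) A"
      using 1 by (subst 3[symmetric]) (simp add: emeasure_distr)
  qed (use 1 2 in auto)
qed

text \<open>A measurable left inverse makes \<open>J\<close> an isomorphism onto its own distribution; measurability of the
image is never an issue.\<close>

lemma mp_iso_distr_borel:
  fixes J :: "'a \<Rightarrow> real"
  assumes [measurable]: "J \<in> measurable N borel" "J' \<in> measurable borel N" 
    and AE: "AE x in N. J' (J x) = x"
  shows "measure_preserving_iso N (distr N borel J) J J'"
proof -
  have "AE y in distr N borel J. J (J' y) = y"
    using AE by (subst AE_distr_iff) (auto elim!: eventually_mono)
  then show ?thesis using AE
    by (auto simp: measure_preserving_iso_def inverse_mod0_def emeasure_distr)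
qed

section \<open>Distribution functions as isomorphisms\<close>

definition uniform01 :: "real measure" where
  "uniform01 = restrict_space lborel {0<..<1}"

lemma space_uniform01 [simp]: "space uniform01 = {0<..<1}" 
  by (simp add: uniform01_def space_restrict_space)

lemma sets_uniform01: "sets uniform01 = sets (restrict_space borel {0<..<1::real})" 
  unfolding uniform01_def by (rule sets_restrict_space_cong) simp

lemma sets_uniform01_iff: "A \<in> sets uniform01 \<longleftrightarrow> A \<in> sets borel \<and> A \<subseteq> {0<..<1}" 
  by (simp add: uniform01_def sets_restrict_space_iff, blast)

lemma emeasure_uniform01: "A \<subseteq> {0<..<1} \<Longrightarrow> emeasure uniform01 A = emeasure lborel A" 
  by (simp add: uniform01_def emeasure_restrict_space)

lemma prob_space_uniform01: "prob_space uniform01"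
  by (rule prob_spaceI) (simp add: emeasure_uniform01)

lemma measurable_uniform01_iff:
  "f \<in> measurable N uniform01 \<longleftrightarrow> f \<in> measurable N borel \<and> f \<in> space N \<rightarrow> {0<..<1}"
  unfolding uniform01_def by (subst measurable_restrict_space2_iff) simp

lemma measurable_from_uniform01: "(\<lambda>x. x) \<in> measurable uniform01 borel"
  unfolding uniform01_def by (auto intro: measurable_restrict_space1)

text \<open>For an atomless law the distribution function is continuous, so the quantile function is a right
inverse of it; being the law of its own quantile function, the measure then sees it as a left
inverse, too. The value \<open>1/2\<close> only serves to make the map land in the open interval everywhere.\<close>

lemma cdf_iso:
  fixes \<sigma> :: "real measure"
  assumes "prob_space \<sigma>" and sets: "sets \<sigma> = sets borel" and null: "\<And>x. emeasure \<sigma> {x} = 0"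
  obtains F' where "measure_preserving_iso \<sigma> uniform01 (\<lambda>x. if cdf \<sigma> x \<in> {0<..<1} then cdf \<sigma> x else 1/2) F'"
    "AE x in \<sigma>. cdf \<sigma> x \<in> {0<..<1}"
proof -
  interpret prob_space \<sigma> by fact
  interpret cdf_distribution \<sigma>
    using sets sets_eq_imp_space_eq[OF sets] by unfold_locales auto
  let ?F = "(\<lambda>x. if cdf \<sigma> x \<in> {0<..<1} then cdf \<sigma> x else 1/2)"
  have cont: "isCont C x" for x using null[of x] by (simp add: isCont_cdf measure_def)
  have I[measurable]: "I \<in> measurable uniform01 borel" 
    using measurable_CI by (simp add: measurable_cong_sets[OF sets_uniform01 refl])
  have d: "distr uniform01 borel I = \<sigma>" using distr_I_eq_M by (simp add: uniform01_def)
  have FI: "C (I w) = w" if w: "0 < w" "w < 1" for w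
  proof (rule antisym)
    show "w \<le> C (I w)" by (rule iffD2[OF pseudoinverse[OF w] order_refl])
    show "C (I w) \<le> w"
    proof (rule tendsto_upperbound)
      show "(C \<longlongrightarrow> C (I w)) (at_left (I w))" using cont[of "I w"] 
        by (auto simp: continuous_at intro: tendsto_within_subset)
      show "\<forall>\<^sub>F i in at_left (I w). C i \<le> w"
        unfolding eventually_at_filter
      proof (intro always_eventually allI impI)
        fix i assume "i \<in> {..<I w}"
        then have "\<not> I w \<le> i" by (simp only: not_le lessThan_iff)
        then have "\<not> w \<le> C i" using iffD1[OF pseudoinverse[OF w]] by blast
        then show "C i \<le> w" by simp
      qed
    qed simp
  qed
  have F: "?F \<in> measurable borel uniform01"
    by (subst measurable_uniform01_iff) auto
  have "measure_preserving_iso uniform01 (distr uniform01 borel I) I ?F"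
    by (rule mp_iso_distr_borel[OF I F]) (auto simp: FI)
  then have 1: "measure_preserving_iso \<sigma> uniform01 ?F I" unfolding d by (rule mp_iso_sym)
  have "AE x in distr uniform01 borel I. C x \<in> {0<..<1}"
    by (subst AE_distr_iff) (auto simp: FI)
  then show ?thesis using that[OF 1] unfolding d by blast
qed

section \<open>Isomorphisms adapted to countable partitions\<close>

lemma mp_iso_AE:
  assumes f: "measure_preserving_iso N P f f'" and "AE y in P. Q y"
  shows "AE x in N. Q (f x)"
proof (rule AE_distrD[OF mp_iso_facts(1)[OF f]])
  show "AE y in distr N P f. Q y" using assms(2) by (simp only: mp_iso_distr[OF f])
qed

lemma mp_iso_emeasure_space:
  assumes f: "measure_preserving_iso N P f f'"
  shows "emeasure N (space N) = emeasure P (space P)"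
proof -
  have "f -` space P \<inter> space N = space N" using measurable_space[OF mp_iso_facts(1)[OF f]] by auto
  then show ?thesis using mp_iso_facts(5)[OF f sets.top] by simp
qed

text \<open>The form in which concrete spaces are recognised: an injection into the line, with measurable
inverse mod 0 and null fibres.\<close>

lemma mp_iso_of_borel_code:
  fixes J :: "'a \<Rightarrow> real"
  assumes "prob_space N" and J: "J \<in> measurable N borel" "J' \<in> measurable borel N" 
    and AE: "AE x in N. J' (J x) = x" and null: "\<And>z. emeasure N (J -` {z} \<inter> space N) = 0"
  obtains u u' where "measure_preserving_iso N uniform01 u u'"
proof -
  interpret prob_space N by fact
  have "prob_space (distr N borel J)" using J(1) by (rule prob_space_distr)
  then obtain F' where "measure_preserving_iso (distr N borel J) uniform01 
      (\<lambda>x. if cdf (distr N borel J) x \<in> {0<..<1} then cdf (distr N borel J) x else 1/2) F'"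
    by (rule cdf_iso) (use null J in \<open>auto simp: emeasure_distr\<close>)
  from mp_iso_comp[OF mp_iso_distr_borel[OF J AE] this] show ?thesis by (rule that)
qed

text \<open>Given a partition of the space into the level sets of \<open>idx\<close>, the coordinate \<open>u\<close> can be chosen
increasing along the cells: those with index at most \<open>j\<close> fill the interval from \<open>0\<close> to their total mass.
The point \<open>y\<close> of the interval in cell \<open>i\<close> is recoded as \<open>i + y/2\<close>, so that the integer part is the
index, and the distribution function of this code is used.\<close>

lemma uniformize_along_index:
  assumes f: "measure_preserving_iso N (completion uniform01) f f'"
    and idx: "idx \<in> measurable N (count_space (UNIV :: nat set))"
  obtains u u' where "measure_preserving_iso N (completion uniform01) u u'"
    "\<And>j. AE x in N. idx x \<le> j \<longleftrightarrow> u x < measure N {x \<in> space N. idx x \<le> j}"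
proof -
  let ?U = uniform01
  interpret U: prob_space ?U by (rule prob_space_uniform01)
  note fm = mp_iso_facts[OF f]
  have "(\<lambda>x. real (idx (f' x))) \<in> borel_measurable (completion ?U)"
    by (rule measurable_compose[OF measurable_compose[OF fm(2) idx]]) simp
  then obtain h where [measurable]: "h \<in> borel_measurable ?U" and h: "AE x in ?U. real (idx (f' x)) = h x"
    using completion_ex_borel_measurable_real by blast
  define i2 where "i2 x = nat \<lfloor>h x\<rfloor>" for x
  have i2m[measurable]: "i2 \<in> measurable ?U (count_space UNIV)" unfolding i2_def by measurable
  have i2: "AE x in ?U. idx (f' x) = i2 x" using h 
  proof eventually_elim
    case (elim x)
    show ?case unfolding i2_def elim[symmetric] by simp
  qed
  \<comment> \<open>The half keeps the code of cell \<open>i\<close> inside \<open>(i, i+1/2)\<close>, away from the next integer.\<close>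
  define f2 where "f2 x = real (i2 x) + x / 2" for x
  define f2' where "f2' z = (let y = 2 * (z - of_int \<lfloor>z\<rfloor>) in if y \<in> {0<..<1} then y else 1/2)" for z :: real
  have f2m[measurable]: "f2 \<in> borel_measurable ?U" unfolding f2_def
    by (intro borel_measurable_add borel_measurable_divide measurable_from_uniform01 borel_measurable_const
        measurable_compose[OF i2m]) simp_all
  have "f2' \<in> borel_measurable borel" unfolding f2'_def Let_def by measurable
  then have f2'm[measurable]: "f2' \<in> measurable borel ?U"
    by (subst measurable_uniform01_iff) (auto simp: f2'_def Let_def)
  have inv: "f2' (f2 x) = x" if "x \<in> {0<..<1}" for x
  proof -
    have "\<lfloor>f2 x\<rfloor> = int (i2 x)" using that by (intro floor_unique) (auto simp: f2_def)
    then show ?thesis using that by (simp add: f2'_def f2_def)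
  qed
  define \<sigma> where "\<sigma> = distr ?U borel f2"
  have null: "emeasure \<sigma> {z} = 0" for z
  proof -
    have sub: "f2 -` {z} \<inter> space ?U \<subseteq> {f2' z}" using inv by auto
    have "f2' z \<in> {0<..<1}" using measurable_space[OF f2'm] by simp
    then have 0: "emeasure ?U {f2' z} = 0" by (subst emeasure_uniform01) auto
    have "emeasure ?U (f2 -` {z} \<inter> space ?U) \<le> emeasure ?U {f2' z}"
      using sub \<open>f2' z \<in> {0<..<1}\<close> by (intro emeasure_mono) (auto simp: sets_uniform01_iff)
    then show ?thesis by (simp add: \<sigma>_def emeasure_distr 0)
  qed
  have 1: "measure_preserving_iso ?U \<sigma> f2 f2'" unfolding \<sigma>_def
    by (rule mp_iso_distr_borel) (auto simp: inv)
  have p\<sigma>: "prob_space \<sigma>" unfolding \<sigma>_def by (rule U.prob_space_distr) measurable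
  let ?F = "\<lambda>x. if cdf \<sigma> x \<in> {0<..<1} then cdf \<sigma> x else 1/2"
  obtain F' where F': "measure_preserving_iso \<sigma> ?U ?F F'" and F1: "AE x in \<sigma>. cdf \<sigma> x \<in> {0<..<1}"
    by (rule cdf_iso[OF p\<sigma>]) (use null in \<open>auto simp: \<sigma>_def\<close>)
  define V where "V = ?F \<circ> f2"
  define V' where "V' = f2' \<circ> F'"
  have V: "measure_preserving_iso ?U ?U V V'" unfolding V_def V'_def by (rule mp_iso_comp[OF 1 F'])
  define s where "s j = measure ?U {x \<in> space ?U. i2 x \<le> j}" for j
  interpret \<sigma>: finite_borel_measure \<sigma>
    using p\<sigma> by (auto simp: finite_borel_measure_def finite_borel_measure_axioms_def \<sigma>_def prob_space.finite_measure)
  have f2_le: "f2 x \<le> real j + 1 \<longleftrightarrow> i2 x \<le> j" if "x \<in> {0<..<1}" for x j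
  proof
    assume "f2 x \<le> real j + 1"
    then have "real (i2 x) < real j + 1" using that by (auto simp: f2_def)
    then show "i2 x \<le> j" by linarith
  next
    assume "i2 x \<le> j"
    then have "real (i2 x) \<le> real j" by simp
    then show "f2 x \<le> real j + 1" using that unfolding f2_def greaterThanLessThan_iff by linarith
  qed
  have cs: "cdf \<sigma> (real j + 1) = s j" for j
    unfolding cdf_def s_def \<sigma>_def by (subst measure_distr) (auto intro!: arg_cong[where f="measure ?U"] simp: f2_le)
  \<comment> \<open>Monotonicity gives only weak inequalities; equality occurs on a null set as \<open>V\<close> is uniform.\<close>
  have Vs: "AE x in ?U. i2 x \<le> j \<longleftrightarrow> V x < s j" for j
  proof -
    have "AE y in ?U. y \<noteq> s j"
    proof (cases "s j \<in> {0<..<1}")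
      case True
      then have "{s j} \<in> null_sets ?U" 
        by (auto simp: null_sets_def sets_uniform01_iff emeasure_uniform01)
      then show ?thesis by (auto dest: AE_not_in)
    qed auto
    from mp_iso_AE[OF V this] have a: "AE x in ?U. V x \<noteq> s j" .
    have b: "AE x in ?U. cdf \<sigma> (f2 x) \<in> {0<..<1}" using mp_iso_AE[OF 1 F1] .
    from a b show ?thesis using AE_space
    proof eventually_elim
      case (elim x)
      then have Vx: "V x = cdf \<sigma> (f2 x)" by (simp add: V_def)
      have "i2 x \<le> j \<Longrightarrow> V x \<le> s j" using f2_le[of x j] elim(3)
        unfolding Vx cs[symmetric] by (intro \<sigma>.cdf_nondecreasing) auto
      moreover have "\<not> i2 x \<le> j \<Longrightarrow> s j \<le> V x" using f2_le[of x j] elim(3)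
        unfolding Vx cs[symmetric] by (intro \<sigma>.cdf_nondecreasing) auto
      ultimately show ?case using elim(1) by force
    qed
  qed
  have sN: "measure N {x \<in> space N. idx x \<le> j} = s j" for j
  proof -
    have A: "{x \<in> space N. idx x \<le> j} \<in> sets N" using idx by measurable
    have "emeasure N {x \<in> space N. idx x \<le> j} = emeasure (completion ?U) (f' -` {x \<in> space N. idx x \<le> j} \<inter> space ?U)"
      using fm(6)[OF A] by simp
    also have "\<dots> = emeasure (completion ?U) {x \<in> space ?U. i2 x \<le> j}"
    proof (rule emeasure_eq_AE)
      show "AE x in completion ?U. x \<in> f' -` {x \<in> space N. idx x \<le> j} \<inter> space ?U \<longleftrightarrow> x \<in> {x \<in> space ?U. i2 x \<le> j}"
        using AE_completion[OF i2] AE_space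
        by eventually_elim (use measurable_space[OF fm(2)] in auto)
      show "f' -` {x \<in> space N. idx x \<le> j} \<inter> space ?U \<in> sets (completion ?U)"
        using measurable_sets[OF fm(2) A] by simp
      show "{x \<in> space ?U. i2 x \<le> j} \<in> sets (completion ?U)"
        by (rule sets_completionI_sets) measurable
    qed
    also have "\<dots> = emeasure ?U {x \<in> space ?U. i2 x \<le> j}"
    proof -
      have "{x \<in> space ?U. i2 x \<le> j} \<in> sets ?U" by measurable
      then show ?thesis by (simp only: emeasure_completion[OF sets_completionI_sets] main_part)
    qed
    finally show ?thesis by (simp only: measure_def s_def)
  qed
  have "AE y in completion ?U. idx (f' y) \<le> j \<longleftrightarrow> V y < s j" for j
    using AE_completion[OF Vs[of j]] AE_completion[OF i2] by eventually_elim simp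
  from mp_iso_AE[OF f this] have "AE x in N. idx (f' (f x)) \<le> j \<longleftrightarrow> V (f x) < s j" for j .
  then have "AE x in N. idx x \<le> j \<longleftrightarrow> (V \<circ> f) x < s j" for j
    using fm(3) by eventually_elim simp
  with mp_iso_comp[OF f mp_iso_completion[OF V]] show ?thesis by (intro that) (auto simp: sN)
qed

text \<open>After both spaces are laid out on the interval along their indices, identity of the interval is the
required isomorphism: the two thresholds that separate indices at most \<open>j\<close> from larger ones are the
two masses, and disagreement happens exactly between them. Equal masses give agreement almost
everywhere, nearly equal ones a small error.\<close>

lemma iso_matching_indices:
  assumes N: "measure_preserving_iso N (completion uniform01) f f'"
    and N': "measure_preserving_iso N' (completion uniform01) k k'"
    and idx[measurable]: "idx \<in> measurable N (count_space (UNIV :: nat set))"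
    and idx'[measurable]: "idx' \<in> measurable N' (count_space (UNIV :: nat set))"
  obtains r r' where "measure_preserving_iso N N' r r'"
    "\<And>j. measure N {x \<in> space N. (idx x \<le> j) \<noteq> (idx' (r x) \<le> j)}
       = \<bar>measure N {x \<in> space N. idx x \<le> j} - measure N' {x \<in> space N'. idx' x \<le> j}\<bar>"
proof -
  let ?U = uniform01
  define s where "s j = measure N {x \<in> space N. idx x \<le> j}" for j
  define t where "t j = measure N' {x \<in> space N'. idx' x \<le> j}" for j
  obtain u u' where u: "measure_preserving_iso N (completion ?U) u u'" 
    and us: "\<And>j. AE x in N. idx x \<le> j \<longleftrightarrow> u x < s j"
    unfolding s_def by (rule uniformize_along_index[OF N idx]) blast
  obtain v v' where v: "measure_preserving_iso N' (completion ?U) v v'" 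
    and vt: "\<And>j. AE x in N'. idx' x \<le> j \<longleftrightarrow> v x < t j"
    unfolding t_def by (rule uniformize_along_index[OF N' idx']) blast
  have r: "measure_preserving_iso N N' (v' \<circ> u) (u' \<circ> v)" by (rule mp_iso_comp[OF u mp_iso_sym[OF v]])
  note [measurable] = mp_iso_facts(1)[OF r] mp_iso_facts(1)[OF u]
  interpret U: prob_space "completion ?U" 
    by (rule prob_spaceI) (simp add: emeasure_uniform01 main_part sets_uniform01_iff)
  have "emeasure N (space N) = 1" using mp_iso_emeasure_space[OF u] U.emeasure_space_1 by simp
  then interpret N: prob_space N by (rule prob_spaceI)
  have "emeasure N' (space N') = 1" using mp_iso_emeasure_space[OF v] U.emeasure_space_1 by simp
  then interpret N': prob_space N' by (rule prob_spaceI)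
  have "measure N {x \<in> space N. (idx x \<le> j) \<noteq> (idx' ((v' \<circ> u) x) \<le> j)} = \<bar>s j - t j\<bar>" for j
  proof -
    define a where "a = min (s j) (t j)"
    define b where "b = max (s j) (t j)"
    have "0 \<le> s j" "s j \<le> 1" "0 \<le> t j" "t j \<le> 1" by (simp_all add: s_def t_def)
    then have st: "0 \<le> a" "b \<le> 1" "a \<le> b" and ba: "b - a = \<bar>s j - t j\<bar>" 
      unfolding a_def b_def by linarith+
    have B: "{a..<b} \<inter> {0<..<1} \<in> sets ?U" by (auto simp: sets_uniform01_iff)
    have "AE x in N. v ((v' \<circ> u) x) = u x" using mp_iso_AE[OF u mp_iso_facts(4)[OF v]] by simp
    with us[of j] mp_iso_AE[OF r vt[of j]] 
    have ae: "AE x in N. (idx x \<le> j) \<noteq> (idx' ((v' \<circ> u) x) \<le> j) \<longleftrightarrow> u x \<in> {a..<b}"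
    proof eventually_elim
      case (elim x)
      then show ?case unfolding atLeastLessThan_iff a_def b_def by linarith
    qed
    have "emeasure N {x \<in> space N. (idx x \<le> j) \<noteq> (idx' ((v' \<circ> u) x) \<le> j)}
      = emeasure N (u -` ({a..<b} \<inter> {0<..<1}) \<inter> space N)"
    proof (rule emeasure_eq_AE)
      show "AE x in N. x \<in> {x \<in> space N. (idx x \<le> j) \<noteq> (idx' ((v' \<circ> u) x) \<le> j)} \<longleftrightarrow>
          x \<in> u -` ({a..<b} \<inter> {0<..<1}) \<inter> space N"
        using ae AE_space
      proof eventually_elim
        case (elim x)
        then have "u x \<in> {0<..<1}" using measurable_space[OF mp_iso_facts(1)[OF u]] by simp
        with elim show ?case by simp
      qed
      show "u -` ({a..<b} \<inter> {0<..<1}) \<inter> space N \<in> sets N"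
        using B by (intro measurable_sets[OF mp_iso_facts(1)[OF u]]) auto
      have [measurable]: "(\<lambda>x. idx' ((v' \<circ> u) x)) \<in> measurable N (count_space UNIV)"
        by (rule measurable_compose[OF mp_iso_facts(1)[OF r] idx'])
      show "{x \<in> space N. (idx x \<le> j) \<noteq> (idx' ((v' \<circ> u) x) \<le> j)} \<in> sets N" by measurable
    qed
    also have "\<dots> = emeasure (completion ?U) ({a..<b} \<inter> {0<..<1})"
      using B by (intro mp_iso_facts(5)[OF u]) auto
    also have "\<dots> = emeasure lborel ({a..<b} \<inter> {0<..<1})"
      using B by (simp add: emeasure_uniform01)
    also have "\<dots> = emeasure lborel {a..<b}"
      using st AE_lborel_singleton[of 0] by (intro emeasure_eq_AE) (auto elim!: eventually_mono)
    also have "\<dots> = ennreal \<bar>s j - t j\<bar>" using st ba by simp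
    finally show ?thesis by (simp add: measure_def)
  qed
  then show ?thesis using that[OF r] by (simp add: s_def t_def)
qed

section \<open>Disjoint sums and the law of the coordinate\<close>

lemma suminf_swap_ennreal:
  fixes f :: "nat \<Rightarrow> nat \<Rightarrow> ennreal"
  shows "(\<Sum>i. \<Sum>j. f i j) = (\<Sum>j. \<Sum>i. f i j)"
proof -
  have "(\<Sum>i. \<Sum>j. f i j) = (\<integral>\<^sup>+i. (\<Sum>j. f i j) \<partial>count_space UNIV)"
    by (simp add: nn_integral_count_space_nat)
  also have "\<dots> = (\<Sum>j. \<integral>\<^sup>+i. f i j \<partial>count_space UNIV)"
    by (rule nn_integral_suminf) simp
  also have "\<dots> = (\<Sum>j. \<Sum>i. f i j)" by (simp add: nn_integral_count_space_nat)
  finally show ?thesis .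
qed

lemma suminf_add_ennreal:
  fixes f g :: "nat \<Rightarrow> ennreal"
  shows "(\<Sum>i. f i + g i) = suminf f + suminf g"
  by (rule suminf_add[symmetric]) auto

text \<open>The sums are defined by \<open>measure_of\<close>, so that their sets and values are only known once the
generating family is a \<open>\<sigma>\<close>-algebra and the set function is countably additive.\<close>

lemma disjoint_sum_sets_aux:
  "sigma_algebra (space M <+> space N)
     {X. X \<subseteq> space M <+> space N \<and> Inl -` X \<in> sets M \<and> Inr -` X \<in> sets N}"
  unfolding sigma_algebra_iff2
proof (intro conjI ballI allI impI)
  fix s assume "s \<in> {X. X \<subseteq> space M <+> space N \<and> Inl -` X \<in> sets M \<and> Inr -` X \<in> sets N}"
  moreover have "Inl -` (space M <+> space N - s) = space M - Inl -` s"
    "Inr -` (space M <+> space N - s) = space N - Inr -` s" by auto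
  ultimately show "space M <+> space N - s \<in> 
      {X. X \<subseteq> space M <+> space N \<and> Inl -` X \<in> sets M \<and> Inr -` X \<in> sets N}" by (simp add: sets.compl_sets)
next
  fix A :: "nat \<Rightarrow> ('a + 'b) set"
  assume "range A \<subseteq> {X. X \<subseteq> space M <+> space N \<and> Inl -` X \<in> sets M \<and> Inr -` X \<in> sets N}"
  then have "A i \<subseteq> space M <+> space N" "Inl -` A i \<in> sets M" "Inr -` A i \<in> sets N" for i by auto
  then show "(\<Union>i. A i) \<in> {X. X \<subseteq> space M <+> space N \<and> Inl -` X \<in> sets M \<and> Inr -` X \<in> sets N}"
    by (auto simp: vimage_UN)
qed auto

lemma space_disjoint_sum [simp]: "space (disjoint_sum M N) = space M <+> space N"
  unfolding disjoint_sum_def by (rule space_measure_of_conv)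

lemma sets_disjoint_sum:
  "sets (disjoint_sum M N) =
     {X. X \<subseteq> space M <+> space N \<and> Inl -` X \<in> sets M \<and> Inr -` X \<in> sets N}"
  unfolding disjoint_sum_def by (rule sigma_algebra.sets_measure_of_eq[OF disjoint_sum_sets_aux])

lemma emeasure_disjoint_sum:
  assumes "X \<in> sets (disjoint_sum M N)"
  shows "emeasure (disjoint_sum M N) X = emeasure M (Inl -` X) + emeasure N (Inr -` X)"
  unfolding disjoint_sum_def
proof (rule emeasure_measure_of_sigma[OF disjoint_sum_sets_aux])
  let ?S = "{X. X \<subseteq> space M <+> space N \<and> Inl -` X \<in> sets M \<and> Inr -` X \<in> sets N}"
  show "positive ?S (\<lambda>X. emeasure M (Inl -` X) + emeasure N (Inr -` X))"
    by (simp add: positive_def)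
  show "countably_additive ?S (\<lambda>X. emeasure M (Inl -` X) + emeasure N (Inr -` X))"
  proof (rule countably_additiveI)
    fix A :: "nat \<Rightarrow> ('a + 'b) set" assume A: "range A \<subseteq> ?S" and d: "disjoint_family A"
    have "(\<Sum>i. emeasure M (Inl -` A i)) = emeasure M (\<Union>i. Inl -` A i)"
      using A d by (intro suminf_emeasure) (auto simp: disjoint_family_on_def vimage_Int[symmetric])
    moreover have "(\<Sum>i. emeasure N (Inr -` A i)) = emeasure N (\<Union>i. Inr -` A i)"
      using A d by (intro suminf_emeasure) (auto simp: disjoint_family_on_def vimage_Int[symmetric])
    ultimately show "(\<Sum>i. emeasure M (Inl -` A i) + emeasure N (Inr -` A i)) =
        emeasure M (Inl -` \<Union>(range A)) + emeasure N (Inr -` \<Union>(range A))"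
      by (simp add: suminf_add_ennreal vimage_UN)
  qed
  show "X \<in> ?S" using assms by (simp only: sets_disjoint_sum)
qed

lemma measurable_Inl_disjoint_sum: "Inl \<in> measurable M (disjoint_sum M N)"
proof (rule measurableI)
  fix A assume "A \<in> sets (disjoint_sum M N)"
  then have A: "Inl -` A \<in> sets M" by (simp add: sets_disjoint_sum)
  then show "Inl -` A \<inter> space M \<in> sets M" by simp
qed auto

lemma measurable_Inr_disjoint_sum: "Inr \<in> measurable N (disjoint_sum M N)"
proof (rule measurableI)
  fix A assume "A \<in> sets (disjoint_sum M N)"
  then have A: "Inr -` A \<in> sets N" by (simp add: sets_disjoint_sum)
  then show "Inr -` A \<inter> space N \<in> sets N" by simp
qed auto

lemma measurable_from_disjoint_sum:
  assumes f: "(\<lambda>x. f (Inl x)) \<in> measurable M P" and g: "(\<lambda>x. f (Inr x)) \<in> measurable N P"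
  shows "f \<in> measurable (disjoint_sum M N) P"
proof (rule measurableI)
  fix x assume "x \<in> space (disjoint_sum M N)"
  then show "f x \<in> space P" using measurable_space[OF f] measurable_space[OF g] by auto
next
  fix A assume A: "A \<in> sets P"
  have "Inl -` (f -` A \<inter> space (disjoint_sum M N)) = (\<lambda>x. f (Inl x)) -` A \<inter> space M"
    "Inr -` (f -` A \<inter> space (disjoint_sum M N)) = (\<lambda>x. f (Inr x)) -` A \<inter> space N" by auto
  then show "f -` A \<inter> space (disjoint_sum M N) \<in> sets (disjoint_sum M N)"
    using measurable_sets[OF f A] measurable_sets[OF g A] by (auto simp: sets_disjoint_sum)
qed

lemma AE_disjoint_sum:
  assumes "AE x in M. P (Inl x)" "AE y in N. P (Inr y)"
  shows "AE z in disjoint_sum M N. P z"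
proof -
  obtain A B where A: "A \<in> null_sets M" "{x \<in> space M. \<not> P (Inl x)} \<subseteq> A"
    and B: "B \<in> null_sets N" "{x \<in> space N. \<not> P (Inr x)} \<subseteq> B"
    using assms unfolding eventually_ae_filter by auto
  have "Inl -` (A <+> B) = A" "Inr -` (A <+> B) = B" by auto
  moreover have "A \<subseteq> space M" "B \<subseteq> space N" using A(1) B(1) by (auto dest: null_sets.sets_into_space)
  ultimately have s: "A <+> B \<in> sets (disjoint_sum M N)" using A(1) B(1) 
    by (auto simp: sets_disjoint_sum)
  with \<open>Inl -` (A <+> B) = A\<close> \<open>Inr -` (A <+> B) = B\<close> A(1) B(1) 
  have "A <+> B \<in> null_sets (disjoint_sum M N)" by (auto simp: emeasure_disjoint_sum null_sets_def)
  then show ?thesis using A(2) B(2) by (intro AE_I') auto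
qed

lemma disjoint_family_sum_sets_aux:
  "sigma_algebra (SIGMA j:UNIV. space (M j))
     {X. X \<subseteq> (SIGMA j:UNIV. space (M j)) \<and> (\<forall>j::nat. Pair j -` X \<in> sets (M j))}"
  unfolding sigma_algebra_iff2
proof (intro conjI ballI allI impI)
  fix s assume "s \<in> {X. X \<subseteq> (SIGMA j:UNIV. space (M j)) \<and> (\<forall>j. Pair j -` X \<in> sets (M j))}"
  moreover have "Pair j -` ((SIGMA j:UNIV. space (M j)) - s) = space (M j) - Pair j -` s" for j by auto
  ultimately show "(SIGMA j:UNIV. space (M j)) - s \<in> 
      {X. X \<subseteq> (SIGMA j:UNIV. space (M j)) \<and> (\<forall>j. Pair j -` X \<in> sets (M j))}" by (simp add: sets.compl_sets)
next
  fix A :: "nat \<Rightarrow> (nat \<times> 'a) set"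
  assume "range A \<subseteq> {X. X \<subseteq> (SIGMA j:UNIV. space (M j)) \<and> (\<forall>j. Pair j -` X \<in> sets (M j))}"
  then have "A i \<subseteq> (SIGMA j:UNIV. space (M j))" "Pair j -` A i \<in> sets (M j)" for i j by auto
  then show "(\<Union>i. A i) \<in> {X. X \<subseteq> (SIGMA j:UNIV. space (M j)) \<and> (\<forall>j. Pair j -` X \<in> sets (M j))}"
    unfolding mem_Collect_eq vimage_UN by blast
qed auto

lemma space_disjoint_family_sum [simp]:
  "space (disjoint_family_sum M) = (SIGMA j:UNIV. space (M j))"
  unfolding disjoint_family_sum_def by (rule space_measure_of_conv)

lemma sets_disjoint_family_sum:
  "sets (disjoint_family_sum M) =
     {X. X \<subseteq> (SIGMA j:UNIV. space (M j)) \<and> (\<forall>j. Pair j -` X \<in> sets (M j))}"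
  unfolding disjoint_family_sum_def
  by (rule sigma_algebra.sets_measure_of_eq[OF disjoint_family_sum_sets_aux])

lemma emeasure_disjoint_family_sum:
  assumes "X \<in> sets (disjoint_family_sum M)"
  shows "emeasure (disjoint_family_sum M) X = (\<Sum>j. emeasure (M j) (Pair j -` X))"
  unfolding disjoint_family_sum_def
proof (rule emeasure_measure_of_sigma[OF disjoint_family_sum_sets_aux])
  let ?S = "{X. X \<subseteq> (SIGMA j:UNIV. space (M j)) \<and> (\<forall>j. Pair j -` X \<in> sets (M j))}"
  show "positive ?S (\<lambda>X. \<Sum>j. emeasure (M j) (Pair j -` X))"
    by (simp add: positive_def)
  show "countably_additive ?S (\<lambda>X. \<Sum>j. emeasure (M j) (Pair j -` X))"
  proof (rule countably_additiveI)
    fix A :: "nat \<Rightarrow> (nat \<times> 'a) set" assume A: "range A \<subseteq> ?S" and d: "disjoint_family A"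
    have "(\<Sum>i. emeasure (M j) (Pair j -` A i)) = emeasure (M j) (\<Union>i. Pair j -` A i)" for j
      using A d by (intro suminf_emeasure) (auto simp: disjoint_family_on_def vimage_Int[symmetric])
    then show "(\<Sum>i. \<Sum>j. emeasure (M j) (Pair j -` A i)) = 
        (\<Sum>j. emeasure (M j) (Pair j -` \<Union>(range A)))"
      by (subst suminf_swap_ennreal) (simp add: vimage_UN)
  qed
  show "X \<in> ?S" using assms by (simp only: sets_disjoint_family_sum)
qed

lemma measurable_Pair_disjoint_family_sum: "Pair j \<in> measurable (M j) (disjoint_family_sum M)"
proof (rule measurableI)
  fix A assume "A \<in> sets (disjoint_family_sum M)"
  then have A: "Pair j -` A \<in> sets (M j)" by (simp add: sets_disjoint_family_sum)
  then show "Pair j -` A \<inter> space (M j) \<in> sets (M j)" by simp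
qed auto

lemma measurable_from_disjoint_family_sum:
  assumes f: "\<And>j. (\<lambda>x. f (j, x)) \<in> measurable (M j) P"
  shows "f \<in> measurable (disjoint_family_sum M) P"
proof (rule measurableI)
  fix x assume "x \<in> space (disjoint_family_sum M)"
  then show "f x \<in> space P" using measurable_space[OF f] by auto
next
  fix A assume A: "A \<in> sets P"
  have "Pair j -` (f -` A \<inter> space (disjoint_family_sum M)) = (\<lambda>x. f (j, x)) -` A \<inter> space (M j)" for j by auto
  then show "f -` A \<inter> space (disjoint_family_sum M) \<in> sets (disjoint_family_sum M)"
    using measurable_sets[OF f A] by (auto simp: sets_disjoint_family_sum)
qed

lemma AE_disjoint_family_sum:
  assumes "\<And>j. AE x in M j. P (j, x)"
  shows "AE z in disjoint_family_sum M. P z"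
proof -
  have "\<forall>j. \<exists>A. A \<in> null_sets (M j) \<and> {x \<in> space (M j). \<not> P (j, x)} \<subseteq> A"
    using assms unfolding eventually_ae_filter by auto
  then obtain A where A: "\<And>j. A j \<in> null_sets (M j)" "\<And>j. {x \<in> space (M j). \<not> P (j, x)} \<subseteq> A j"
    by metis
  have v: "Pair j -` (SIGMA j:UNIV. A j) = A j" for j by auto
  have "A j \<subseteq> space (M j)" for j using A(1) by (auto dest: null_sets.sets_into_space)
  then have s: "(SIGMA j:UNIV. A j) \<in> sets (disjoint_family_sum M)" using A(1)
    by (auto simp: sets_disjoint_family_sum v)
  with A(1) have "(SIGMA j:UNIV. A j) \<in> null_sets (disjoint_family_sum M)"
    by (auto simp: emeasure_disjoint_family_sum null_sets_def v)
  then show ?thesis using A(2) by (intro AE_I') auto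
qed

lemma space_Rpos [simp]: "space Rpos = {0<..}" 
  by (simp add: Rpos_def space_restrict_space)

lemma sets_Rpos_iff: "E \<in> sets Rpos \<longleftrightarrow> E \<in> sets borel \<and> E \<subseteq> {0<..}" 
  by (simp add: Rpos_def sets_restrict_space_iff, blast)

lemma measurable_Rpos_iff:
  "f \<in> measurable N Rpos \<longleftrightarrow> f \<in> measurable N borel \<and> f \<in> space N \<rightarrow> {0<..}"
  unfolding Rpos_def by (subst measurable_restrict_space2_iff) simp

lemma measurable_Rpos_borel: "f \<in> borel_measurable borel \<Longrightarrow> f \<in> borel_measurable Rpos"
  unfolding Rpos_def by (rule measurable_restrict_space1)

abbreviation unit_lborel :: "real measure" where
  "unit_lborel \<equiv> restrict_space lborel {0..1}"

lemma prob_space_unit_lborel: "prob_space unit_lborel"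
  by (rule prob_spaceI) (simp add: emeasure_restrict_space space_restrict_space)

text \<open>The space \<open>\<L>\<close> before completion. Its maps and partitions are Borel, and \<open>mp_iso_completion\<close> transfers them.\<close>

definition L_borel :: "(nat \<Rightarrow> real measure) \<Rightarrow> real measure \<Rightarrow> (nat \<times> real + real \<times> real) measure" where
  "L_borel \<nu> \<nu>_inf = disjoint_sum (disjoint_family_sum \<nu>) (\<nu>_inf \<Otimes>\<^sub>M unit_lborel)"

lemma L_space_eq: "L_space \<nu> \<nu>_inf = completion (L_borel \<nu> \<nu>_inf)"
  by (simp add: L_space_def L_borel_def)

lemma emeasure_add_measure:
  assumes "sets N = sets M" "E \<in> sets M"
  shows "emeasure (add_measure M N) E = emeasure M E + emeasure N E"
  unfolding add_measure_def
proof (rule emeasure_measure_of_sigma[OF sets.sigma_algebra_axioms])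
  show "countably_additive (sets M) (\<lambda>E. emeasure M E + emeasure N E)"
    using assms(1) by (intro countably_additiveI) (simp add: suminf_add_ennreal suminf_emeasure)
qed (use assms in \<open>auto simp: positive_def\<close>)

lemma emeasure_total_measure:
  assumes "\<And>j. sets (\<nu> j) = sets Rpos" "sets \<nu>_inf = sets Rpos" "E \<in> sets Rpos"
  shows "emeasure (total_measure \<nu> \<nu>_inf) E = (\<Sum>j. emeasure (\<nu> j) E) + emeasure \<nu>_inf E"
  unfolding total_measure_def
proof (rule emeasure_measure_of_sigma[OF sets.sigma_algebra_axioms])
  show "countably_additive (sets Rpos) (\<lambda>E. (\<Sum>j. emeasure (\<nu> j) E) + emeasure \<nu>_inf E)"
  proof (intro countably_additiveI)
    fix A :: "nat \<Rightarrow> real set" assume A: "range A \<subseteq> sets Rpos" "disjoint_family A"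
    then have "(\<Sum>i. emeasure (\<nu> j) (A i)) = emeasure (\<nu> j) (\<Union>(range A))" for j
      using assms by (intro suminf_emeasure) auto
    moreover have "(\<Sum>i. emeasure \<nu>_inf (A i)) = emeasure \<nu>_inf (\<Union>(range A))"
      using assms A by (intro suminf_emeasure) auto
    ultimately show "(\<Sum>i. (\<Sum>j. emeasure (\<nu> j) (A i)) + emeasure \<nu>_inf (A i)) =
        (\<Sum>j. emeasure (\<nu> j) (\<Union>(range A))) + emeasure \<nu>_inf (\<Union>(range A))"
      by (subst suminf_add_ennreal, subst suminf_swap_ennreal) simp
  qed
qed (use assms in \<open>auto simp: positive_def\<close>)

lemma sets_total_measure: "sets (total_measure \<nu> \<nu>_inf) = sets Rpos"
  unfolding total_measure_def by (rule sets.sets_measure_of_eq)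

context
  fixes \<nu> :: "nat \<Rightarrow> real measure" and \<nu>_inf :: "real measure"
  assumes sets_\<nu>: "\<And>j. sets (\<nu> j) = sets Rpos" and sets_inf: "sets \<nu>_inf = sets Rpos"
begin

lemma space_\<nu>: "space (\<nu> j) = {0<..}" "space \<nu>_inf = {0<..}"
  using sets_eq_imp_space_eq[OF sets_\<nu>] sets_eq_imp_space_eq[OF sets_inf] by auto

lemma measurable_t_coord: "t_coord \<in> measurable (L_borel \<nu> \<nu>_inf) Rpos"
  unfolding L_borel_def
proof (rule measurable_from_disjoint_sum)
  show "(\<lambda>x. t_coord (Inl x)) \<in> measurable (disjoint_family_sum \<nu>) Rpos"
  proof (rule measurable_from_disjoint_family_sum)
    fix j
    have "(\<lambda>x. x) \<in> measurable (\<nu> j) Rpos"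
      using measurable_ident[of "\<nu> j"] unfolding id_def measurable_cong_sets[OF refl sets_\<nu>] .
    then show "(\<lambda>x. t_coord (Inl (j, x))) \<in> measurable (\<nu> j) Rpos" by simp
  qed
  have "(\<lambda>x. t_coord (Inr x)) = fst" by (auto simp: fun_eq_iff)
  then show "(\<lambda>x. t_coord (Inr x)) \<in> measurable (\<nu>_inf \<Otimes>\<^sub>M unit_lborel) Rpos"
    using measurable_fst[of \<nu>_inf unit_lborel] 
    by (simp only: measurable_cong_sets[OF refl sets_inf])
qed

text \<open>The sheets of \<open>\<L>\<close> all lie over the same half-line, so the law of \<open>t\<close> forgets how \<open>\<nu>\<close> is split into
sheets. For this reason double cosets with different splittings of \<open>\<nu>\<close> can be compared.\<close>

lemma distr_t_coord: "distr (L_borel \<nu> \<nu>_inf) Rpos t_coord = total_measure \<nu> \<nu>_inf"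
proof (rule measure_eqI)
  fix E assume "E \<in> sets (distr (L_borel \<nu> \<nu>_inf) Rpos t_coord)"
  then have E: "E \<in> sets Rpos" by simp
  interpret prob_space unit_lborel by (rule prob_space_unit_lborel)
  let ?X = "t_coord -` E \<inter> space (L_borel \<nu> \<nu>_inf)"
  have X: "?X \<in> sets (L_borel \<nu> \<nu>_inf)" by (rule measurable_sets[OF measurable_t_coord E])
  have Epos: "E \<subseteq> {0<..}" using E by (simp add: sets_Rpos_iff)
  have Inl: "Inl -` ?X = (SIGMA j:UNIV. E)" using Epos by (auto simp: L_borel_def space_\<nu>)
  have Inr: "Inr -` ?X = E \<times> {0..1}" using Epos 
    by (auto simp: L_borel_def space_\<nu> space_pair_measure space_restrict_space)
  have s1: "(SIGMA j:UNIV. E) \<in> sets (disjoint_family_sum \<nu>)"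
    using X Inl by (simp add: L_borel_def sets_disjoint_sum)
  have v: "Pair j -` (SIGMA j:UNIV. E) = E" for j by auto
  have "emeasure (disjoint_family_sum \<nu>) (SIGMA j:UNIV. E) = (\<Sum>j. emeasure (\<nu> j) E)"
    by (subst emeasure_disjoint_family_sum[OF s1]) (simp only: v)
  moreover have "emeasure (\<nu>_inf \<Otimes>\<^sub>M unit_lborel) (E \<times> {0..1}) = emeasure \<nu>_inf E"
    using E sets_inf by (subst emeasure_pair_measure_Times)
      (auto simp: sets_restrict_space_iff emeasure_restrict_space)
  ultimately have "emeasure (L_borel \<nu> \<nu>_inf) ?X = (\<Sum>j. emeasure (\<nu> j) E) + emeasure \<nu>_inf E"
    using X Inl Inr unfolding L_borel_def by (simp only: emeasure_disjoint_sum)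
  then show "emeasure (distr (L_borel \<nu> \<nu>_inf) Rpos t_coord) E = emeasure (total_measure \<nu> \<nu>_inf) E"
    by (simp add: emeasure_distr[OF measurable_t_coord E] emeasure_total_measure[OF sets_\<nu> sets_inf E])
qed (simp add: sets_total_measure)

lemma L_star_space_eq:
  "L_star_space \<nu> \<nu>_inf = completion (density (L_borel \<nu> \<nu>_inf) (\<lambda>p. ennreal (t_coord p)))"
proof -
  have "t_coord \<in> borel_measurable (L_borel \<nu> \<nu>_inf)" using measurable_t_coord by (simp add: measurable_Rpos_iff)
  moreover have "AE p in L_borel \<nu> \<nu>_inf. 0 < ennreal (t_coord p)"
    using measurable_space[OF measurable_t_coord] by (intro AE_I2) auto
  ultimately show ?thesis unfolding L_star_space_def L_space_eq
    by (intro completion_density_eq[symmetric]) auto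
qed

end

section \<open>Atomless spaces isomorphic to the interval\<close>

lemma lebesgue_Int_unit_interval:
  assumes "A \<in> sets lebesgue"
  shows "A \<inter> {0<..<1} \<in> sets (completion uniform01)"
proof -
  obtain S N N' where A: "A = S \<union> N" "N \<subseteq> N'" "N' \<in> null_sets lborel" "S \<in> sets lborel"
    using sets_completionE[OF assms] by metis
  have "emeasure lborel (N' \<inter> {0<..<1}) \<le> emeasure lborel N'"
    using A(3) by (intro emeasure_mono) auto
  then have "N' \<inter> {0<..<1} \<in> null_sets uniform01"
    using A(3) by (auto simp: null_sets_def sets_uniform01_iff emeasure_uniform01)
  then show ?thesis
    using A by (intro sets_completionI[of _ "S \<inter> {0<..<1}" "N \<inter> {0<..<1}" "N' \<inter> {0<..<1}"])
      (auto simp: sets_uniform01_iff)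
qed

text \<open>A subset of the atom is equal mod 0 to the whole atom or to the empty set, which contradicts the
existence of a subset of intermediate measure.\<close>

lemma nonatomic_lebesgue_atoms_null:
  assumes "nonatomic M"
    and f: "measure_preserving_iso M (disjoint_sum N (density (count_space UNIV) p)) f f'"
  shows "p n = 0"
proof (rule ccontr)
  assume pn: "p n \<noteq> 0"
  let ?Y = "disjoint_sum N (density (count_space UNIV) p)"
  note fm = mp_iso_facts[OF f]
  have vi: "Inl -` {Inr n} = {}" "Inr -` {Inr n} = {n}" by auto
  have S: "{Inr n} \<in> sets ?Y" by (auto simp: sets_disjoint_sum vi)
  have "emeasure ?Y {Inr n} = p n"
    by (subst emeasure_disjoint_sum[OF S]) (simp add: vi emeasure_density nn_integral_count_space_indicator)
  then have A: "emeasure M (f -` {Inr n} \<inter> space M) = p n" using fm(5)[OF S] by simp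
  then obtain B where B: "B \<in> sets M" "B \<subseteq> f -` {Inr n} \<inter> space M" "0 < emeasure M B" "emeasure M B < p n"
    using assms(1) pn measurable_sets[OF fm(1) S] unfolding nonatomic_def by (metis not_gr_zero)
  let ?B = "f' -` B \<inter> space ?Y"
  have B': "?B \<in> sets ?Y" by (rule measurable_sets[OF fm(2) B(1)])
  have "emeasure ?Y ?B = emeasure ?Y (?B \<inter> {Inr n})"
  proof (rule emeasure_eq_AE)
    show "AE x in ?Y. (x \<in> ?B) = (x \<in> ?B \<inter> {Inr n})"
      using fm(4)
    proof eventually_elim
      case (elim x)
      have "x \<in> ?B \<Longrightarrow> f (f' x) = Inr n" using B(2) by auto
      with elim show ?case by auto
    qed
  qed (use B' S in auto)
  also have "\<dots> = 0 \<or> \<dots> = emeasure ?Y {Inr n}" by (cases "Inr n \<in> ?B") auto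
  finally show False using fm(6)[OF B(1)] B(3,4) \<open>emeasure ?Y {Inr n} = p n\<close> by auto
qed

lemma lebesgue_space_iso_uniform01:
  assumes "lebesgue_space M" and na: "nonatomic M"
  obtains f f' where "measure_preserving_iso M (completion uniform01) f f'"
proof -
  obtain c :: real and p :: "nat \<Rightarrow> ennreal" and f f' where "prob_space M" "complete_measure M" "0 \<le> c"
    and f0: "measure_preserving_iso M (disjoint_sum (lebesgue_on {0..c}) (density (count_space UNIV) p)) f f'"
    using assms(1) unfolding lebesgue_space_def by auto
  interpret prob_space M by fact
  interpret complete_measure M by fact
  have "p = (\<lambda>_. 0)" using nonatomic_lebesgue_atoms_null[OF na f0] by auto
  define Y where "Y = disjoint_sum (lebesgue_on {0..c}) (density (count_space (UNIV :: nat set)) (\<lambda>_. 0))"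
  have f: "measure_preserving_iso M Y f f'" using f0 \<open>p = _\<close> by (simp add: Y_def)
  note fm = mp_iso_facts[OF f]
  have eY: "emeasure Y X = emeasure (lebesgue_on {0..c}) (Inl -` X)" if "X \<in> sets Y" for X
    using that unfolding Y_def by (subst emeasure_disjoint_sum) (auto simp: emeasure_density)
  have spY: "space Y = {0..c} <+> UNIV" by (simp add: Y_def space_restrict_space)
  have "Inl -` ({0..c} <+> (UNIV :: nat set)) = {0..c}" by auto
  then have "emeasure Y (space Y) = c"
    using eY[OF sets.top] \<open>0 \<le> c\<close> by (simp add: spY emeasure_restrict_space)
  then have c: "c = 1" using mp_iso_emeasure_space[OF f] emeasure_space_1 by simp
  define k0 where "k0 x = (if x \<in> {0<..<1} then x else 1/2)" for x :: real
  define k where "k = case_sum k0 (\<lambda>_::nat. 1/2)"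
  have [measurable]: "k0 \<in> borel_measurable borel" unfolding k0_def by measurable
  have k0: "k0 x \<in> {0<..<1}" for x by (auto simp: k0_def)
  have kb: "k \<in> borel_measurable Y" unfolding Y_def
  proof (rule measurable_from_disjoint_sum)
    show "(\<lambda>x. k (Inl x)) \<in> borel_measurable (lebesgue_on {0..c})"
      by (simp add: k_def) (intro measurable_restrict_space1 measurable_completion, simp)
  qed (simp add: k_def)
  have k: "k \<in> measurable Y uniform01"
    using kb k0 by (subst measurable_uniform01_iff) (auto simp: k_def split: sum.split)
  have kf: "k \<circ> f \<in> measurable M uniform01" by (rule measurable_comp[OF fm(1) k])
  have d: "distr M uniform01 (k \<circ> f) = uniform01"
  proof (rule measure_eqI)
    fix E assume "E \<in> sets (distr M uniform01 (k \<circ> f))"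
    then have E: "E \<in> sets uniform01" by simp
    then have Eb: "E \<in> sets borel" "E \<subseteq> {0<..<1}" by (auto simp: sets_uniform01_iff)
    have kE: "k -` E \<inter> space Y \<in> sets Y" by (rule measurable_sets[OF k E])
    have "(k \<circ> f) -` E \<inter> space M = f -` (k -` E \<inter> space Y) \<inter> space M"
      using measurable_space[OF fm(1)] by auto
    then have "emeasure M ((k \<circ> f) -` E \<inter> space M) = emeasure Y (k -` E \<inter> space Y)"
      using fm(5)[OF kE] by simp
    also have "\<dots> = emeasure (lebesgue_on {0..c}) (k0 -` E \<inter> {0..1})"
    proof -
      have "Inl -` (k -` E \<inter> space Y) = k0 -` E \<inter> {0..1}" by (auto simp: spY k_def c)
      then show ?thesis by (simp only: eY[OF kE])
    qed
    also have "\<dots> = emeasure lebesgue (k0 -` E \<inter> {0..1})"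
      by (rule emeasure_restrict_space) (auto simp: c)
    also have "\<dots> = emeasure lebesgue E"
    proof (rule emeasure_eq_AE)
      show "AE x in lebesgue. (x \<in> k0 -` E \<inter> {0..1}) = (x \<in> E)"
        using AE_completion[OF AE_lborel_singleton[of 0]] AE_completion[OF AE_lborel_singleton[of 1]]
      proof eventually_elim
        case (elim x)
        then show ?case using Eb(2) by (cases "x \<in> {0<..<1}") (auto simp: k0_def)
      qed
      have "k0 -` E \<in> sets borel" using measurable_sets[OF _ Eb(1), of k0 borel] by simp
      then have "k0 -` E \<inter> {0..1} \<in> sets borel" by simp
      then show "k0 -` E \<inter> {0..1} \<in> sets lebesgue" by (intro sets_completionI_sets) simp
      show "E \<in> sets lebesgue" using Eb by (intro sets_completionI_sets) simp
    qed
    also have "\<dots> = emeasure uniform01 E" using Eb by (simp add: emeasure_uniform01)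
    finally show "emeasure (distr M uniform01 (k \<circ> f)) E = emeasure uniform01 E"
      by (simp add: emeasure_distr[OF kf E])
  qed simp
  have kfc: "k \<circ> f \<in> measurable M (completion uniform01)"
    by (rule measurable_completion2[OF kf]) (simp add: d)
  have dc: "distr M (completion uniform01) (k \<circ> f) = completion uniform01"
    using completion_distr_eq[OF kf] d by simp
  have gm: "f' \<circ> Inl \<in> measurable (completion uniform01) M"
  proof (rule measurableI)
    fix x assume "x \<in> space (completion uniform01)"
    then have "Inl x \<in> space Y" by (auto simp: spY c intro!: InlI)
    then show "(f' \<circ> Inl) x \<in> space M" using measurable_space[OF fm(2)] by simp
  next
    fix X assume X: "X \<in> sets M"
    have "Inl -` (f' -` X \<inter> space Y) \<in> sets (lebesgue_on {0..c})"
      using measurable_sets[OF fm(2) X] unfolding Y_def sets_disjoint_sum by simp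
    then have "Inl -` (f' -` X \<inter> space Y) \<in> sets lebesgue"
      by (subst (asm) sets_restrict_space_iff) auto
    then have "Inl -` (f' -` X \<inter> space Y) \<inter> {0<..<1} \<in> sets (completion uniform01)"
      by (rule lebesgue_Int_unit_interval)
    moreover have "Inl -` (f' -` X \<inter> space Y) \<inter> {0<..<1} = (f' \<circ> Inl) -` X \<inter> space (completion uniform01)"
      by (auto simp: spY c)
    ultimately show "(f' \<circ> Inl) -` X \<inter> space (completion uniform01) \<in> sets (completion uniform01)" by simp
  qed
  have "AE y in Y. Inl (k y) = y" unfolding Y_def
  proof (rule AE_disjoint_sum)
    have "AE x in lebesgue. x \<in> {0..c} \<longrightarrow> Inl (k (Inl x)) = (Inl x :: real + nat)"
      using AE_completion[OF AE_lborel_singleton[of 0]] AE_completion[OF AE_lborel_singleton[of 1]]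
      by eventually_elim (auto simp: k_def k0_def c)
    then show "AE x in lebesgue_on {0..c}. Inl (k (Inl x)) = (Inl x :: real + nat)"
      by (subst AE_restrict_space_iff) auto
  qed (simp add: AE_density)
  from mp_iso_AE[OF f this] fm(3) have AE1: "AE x in M. (f' \<circ> Inl) ((k \<circ> f) x) = x"
    by eventually_elim simp
  have AE2: "AE y in completion uniform01. (k \<circ> f) ((f' \<circ> Inl) y) = y"
  proof -
    have "AE y in distr M (completion uniform01) (k \<circ> f). (k \<circ> f) ((f' \<circ> Inl) y) = y"
    proof (subst AE_distr_iff[OF kfc])
      have [measurable]: "(\<lambda>y. (k \<circ> f) ((f' \<circ> Inl) y)) \<in> borel_measurable (completion uniform01)"
        using measurable_compose[OF gm kf] by (simp add: measurable_uniform01_iff)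
      have [measurable]: "(\<lambda>y. y) \<in> borel_measurable (completion uniform01)"
        by (rule measurable_completion[OF measurable_from_uniform01])
      show "{y \<in> space (completion uniform01). (k \<circ> f) ((f' \<circ> Inl) y) = y} \<in> sets (completion uniform01)"
        by measurable
      show "AE x in M. (k \<circ> f) ((f' \<circ> Inl) ((k \<circ> f) x)) = (k \<circ> f) x"
        using AE1 by eventually_elim simp
    qed
    then show ?thesis by (simp only: dc)
  qed
  have "measure_preserving_iso M (completion uniform01) (k \<circ> f) (f' \<circ> Inl)"
    unfolding measure_preserving_iso_def inverse_mod0_def
  proof (intro conjI ballI)
    fix A assume "A \<in> sets (completion uniform01)"
    then show "emeasure M ((k \<circ> f) -` A \<inter> space M) = emeasure (completion uniform01) A"
      by (subst dc[symmetric]) (simp only: emeasure_distr[OF kfc])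
  qed (fact kfc gm AE1 AE2)+
  then show ?thesis by (rule that)
qed

lemma nonatomic_singleton_null:
  assumes "nonatomic N" "{x} \<in> sets N"
  shows "emeasure N {x} = 0"
proof (rule ccontr)
  assume "emeasure N {x} \<noteq> 0"
  then obtain B where "B \<subseteq> {x}" "0 < emeasure N B" "emeasure N B < emeasure N {x}"
    using assms unfolding nonatomic_def by (metis not_gr_zero)
  then show False by (cases "B = {}") (auto simp: subset_singleton_iff)
qed

definition single_sheet :: "real measure \<Rightarrow> nat \<Rightarrow> real measure" where
  "single_sheet \<nu>_c = (\<lambda>j. if j = 0 then \<nu>_c else null_measure Rpos)"

text \<open>The single continuous sheet is sent to the negative half-line by \<open>t \<mapsto> -t\<close>. The measure \<open>\<nu>\<^sup>d\<close> lives on a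
countable set, and the segment over its \<open>n\<close>-th point is sent to \<open>[2n,2n+1]\<close>. The inverse is given by
total functions: \<open>pos\<close>, \<open>unit\<close> and the second case of \<open>d\<close> supply values in the right space outside the
range of the code. Fibres are null since \<open>\<nu>\<^sup>c\<close> and Lebesgue measure have no atoms.\<close>

lemma single_sheet_borel_code:
  assumes sc: "sets \<nu>_c = sets Rpos" and "nonatomic \<nu>_c"
    and sd: "sets \<nu>_d = sets Rpos" and "discrete_measure \<nu>_d"
  obtains J :: "nat \<times> real + real \<times> real \<Rightarrow> real" and J'
  where "J \<in> borel_measurable (L_borel (single_sheet \<nu>_c) \<nu>_d)"
    "J' \<in> measurable borel (L_borel (single_sheet \<nu>_c) \<nu>_d)"
    "AE p in L_borel (single_sheet \<nu>_c) \<nu>_d. J' (J p) = p"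
    "\<And>z. emeasure (L_borel (single_sheet \<nu>_c) \<nu>_d)
        (J -` {z} \<inter> space (L_borel (single_sheet \<nu>_c) \<nu>_d)) = 0"
proof -
  let ?\<nu> = "single_sheet \<nu>_c"
  have s\<nu>: "sets (?\<nu> j) = sets Rpos" for j by (simp add: single_sheet_def sc)
  interpret U: prob_space unit_lborel by (rule prob_space_unit_lborel)
  have spd: "space \<nu>_d = {0<..}" using sets_eq_imp_space_eq[OF sd] by simp
  have sp\<nu>: "space (?\<nu> j) = {0<..}" for j using sets_eq_imp_space_eq[OF s\<nu>] by simp
  obtain C where C: "countable C" "C \<in> sets \<nu>_d" "emeasure \<nu>_d (space \<nu>_d - C) = 0"
    using assms(4) unfolding discrete_measure_def by auto
  have CR: "C \<in> sets Rpos" "C \<in> sets borel" "C \<subseteq> {0<..}" using C(2) sd by (auto simp: sets_Rpos_iff)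
  define e where "e t = (if t \<in> C then to_nat_on C t else 0)" for t
  define d where "d n = (if from_nat_into C n > 0 then from_nat_into C n else 1)" for n
  have de: "d (e t) = t" if "t \<in> C" for t using that C(1) CR(3) by (auto simp: d_def e_def)
  have em: "e \<in> measurable Rpos (count_space UNIV)"
  proof (rule measurableI)
    fix A :: "nat set"
    have "countable (C \<inter> e -` A)" using C(1) by auto
    then have "C \<inter> e -` A \<in> sets borel" by (rule sets.countable[rotated]) auto 
    then have "C \<inter> e -` A \<in> sets Rpos" using CR(3) by (auto simp: sets_Rpos_iff)
    moreover have "e -` A \<inter> space Rpos = (C \<inter> e -` A) \<union> (if 0 \<in> A then space Rpos - C else {})"
      using CR(3) by (auto simp: e_def split: if_splits)
    moreover have "{0<..} \<in> sets Rpos" by (simp add: sets_Rpos_iff)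
    ultimately show "e -` A \<inter> space Rpos \<in> sets Rpos" using CR(1) by auto
  qed simp
  have em': "e \<in> measurable \<nu>_d (count_space UNIV)" using em by (simp only: measurable_cong_sets[OF sd refl])
  define J :: "nat \<times> real + real \<times> real \<Rightarrow> real"
    where "J = case_sum (\<lambda>(j, t). - t) (\<lambda>(t, x). 2 * real (e t) + x)"
  define pos where "pos x = (if x > 0 then x else 1)" for x :: real
  define unit where "unit x = (if x \<in> {0..1} then x else 0)" for x :: real
  define n where "n z = nat \<lfloor>z / 2\<rfloor>" for z :: real
  define J' :: "real \<Rightarrow> nat \<times> real + real \<times> real"
    where "J' z = (if z < 0 then Inl (0, pos (- z)) else Inr (d (n z), unit (z - 2 * real (n z))))" for z
  have Jm: "J \<in> borel_measurable (L_borel ?\<nu> \<nu>_d)" unfolding L_borel_def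
  proof (rule measurable_from_disjoint_sum)
    show "(\<lambda>x. J (Inl x)) \<in> borel_measurable (disjoint_family_sum ?\<nu>)"
    proof (rule measurable_from_disjoint_family_sum)
      fix j
      have "(\<lambda>x::real. - x) \<in> borel_measurable Rpos" by (rule measurable_Rpos_borel) simp
      then show "(\<lambda>x. J (Inl (j, x))) \<in> borel_measurable (?\<nu> j)"
        by (simp add: J_def measurable_cong_sets[OF s\<nu> refl])
    qed
    have [measurable]: "(\<lambda>p. e (fst p)) \<in> measurable (\<nu>_d \<Otimes>\<^sub>M unit_lborel) (count_space UNIV)"
      by (rule measurable_compose[OF measurable_fst em'])
    have 1: "(\<lambda>p. real (e (fst p))) \<in> borel_measurable (\<nu>_d \<Otimes>\<^sub>M unit_lborel)"
      by measurable
    have "(\<lambda>x::real. x) \<in> borel_measurable unit_lborel" by (rule measurable_restrict_space1) simp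
    from measurable_compose[OF measurable_snd this] 
    have 2: "snd \<in> borel_measurable (\<nu>_d \<Otimes>\<^sub>M unit_lborel)" .
    have "(\<lambda>x. J (Inr x)) = (\<lambda>p. 2 * real (e (fst p)) + snd p)" by (auto simp: J_def)
    then show "(\<lambda>x. J (Inr x)) \<in> borel_measurable (\<nu>_d \<Otimes>\<^sub>M unit_lborel)"
      using 1 2 by simp
  qed
  have J'm: "J' \<in> measurable borel (L_borel ?\<nu> \<nu>_d)" 
  proof -
    have p: "(\<lambda>z. pos (- z)) \<in> measurable borel (?\<nu> 0)"
      unfolding measurable_cong_sets[OF refl s\<nu>] measurable_Rpos_iff by (auto simp: pos_def)
    have Inl: "(\<lambda>z. Inl (0::nat, pos (- z))) \<in> measurable borel (L_borel ?\<nu> \<nu>_d)"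
      unfolding L_borel_def
      by (rule measurable_compose[OF measurable_compose[OF p measurable_Pair_disjoint_family_sum[of 0 ?\<nu>]] measurable_Inl_disjoint_sum])
    have nm[measurable]: "n \<in> measurable borel (count_space UNIV)" unfolding n_def by measurable
    have "d \<in> measurable (count_space UNIV) \<nu>_d" by (auto simp: d_def spd)
    from measurable_compose[OF nm this] have dn: "(\<lambda>z. d (n z)) \<in> measurable borel \<nu>_d" .
    have "(\<lambda>z. unit (z - 2 * real (n z))) \<in> borel_measurable borel" unfolding unit_def by measurable
    then have un: "(\<lambda>z. unit (z - 2 * real (n z))) \<in> measurable borel unit_lborel"
      by (subst measurable_restrict_space2_iff) (auto simp: unit_def)
    have Inr: "(\<lambda>z. Inr (d (n z), unit (z - 2 * real (n z)))) \<in> measurable borel (L_borel ?\<nu> \<nu>_d)"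
      unfolding L_borel_def
      by (rule measurable_compose[OF measurable_Pair[OF dn un] measurable_Inr_disjoint_sum])
    show ?thesis unfolding J'_def using Inl Inr by (rule measurable_If) simp
  qed
  have AE: "AE p in L_borel ?\<nu> \<nu>_d. J' (J p) = p" unfolding L_borel_def
  proof (rule AE_disjoint_sum)
    show "AE p in disjoint_family_sum ?\<nu>. J' (J (Inl p)) = Inl p"
    proof (rule AE_disjoint_family_sum)
      fix j
      show "AE x in ?\<nu> j. J' (J (Inl (j, x))) = Inl (j, x)"
      proof (cases "j = 0")
        case True
        then show ?thesis by (intro AE_I2) (auto simp: sp\<nu> J_def J'_def pos_def)
      next
        case False
        then show ?thesis by (intro AE_I'[of "{0<..}"]) 
          (auto simp: single_sheet_def null_sets_def sets_Rpos_iff)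
      qed
    qed
    have C_null: "(space \<nu>_d - C) \<times> {0..1} \<in> null_sets (\<nu>_d \<Otimes>\<^sub>M unit_lborel)"
      using C(2,3) by (auto simp: null_sets_def U.emeasure_pair_measure_Times sets_restrict_space_iff)
    have inv: "J' (J (Inr p)) = Inr p" if p_in: "p \<in> C \<times> {0..1}" for p
    proof -
      obtain t x where p: "p = (t, x)" "t \<in> C" "0 \<le> x" "x \<le> 1" using p_in by (cases p) auto
      have "\<lfloor>J (Inr p) / 2\<rfloor> = int (e t)" using p by (intro floor_unique) (auto simp: J_def)
      then show ?thesis using p by (auto simp: J'_def J_def n_def de unit_def)
    qed
    show "AE p in \<nu>_d \<Otimes>\<^sub>M unit_lborel. J' (J (Inr p)) = Inr p"
      by (rule AE_I'[OF C_null]) (use inv in \<open>auto simp: space_pair_measure space_restrict_space\<close>)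
  qed
  have null: "emeasure (L_borel ?\<nu> \<nu>_d) (J -` {z} \<inter> space (L_borel ?\<nu> \<nu>_d)) = 0" (is "emeasure _ ?X = 0") for z
  proof -
    have X: "?X \<in> sets (L_borel ?\<nu> \<nu>_d)" by (rule measurable_sets[OF Jm]) simp
    have "Inl -` ?X \<in> sets (disjoint_family_sum ?\<nu>)" and Xr: "Inr -` ?X \<in> sets (\<nu>_d \<Otimes>\<^sub>M unit_lborel)"
      using X unfolding L_borel_def sets_disjoint_sum by auto
    have "emeasure (?\<nu> j) (Pair j -` Inl -` ?X) = 0" for j
    proof (cases "j = 0")
      case True
      have "Pair j -` Inl -` ?X = {- z} \<inter> {0<..}" by (auto simp: J_def L_borel_def sp\<nu>)
      moreover have "emeasure \<nu>_c ({- z} \<inter> {0<..}) = 0"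
        using nonatomic_singleton_null[OF assms(2), of "- z"] by (cases "z < 0") (auto simp: sc sets_Rpos_iff)
      moreover have "?\<nu> j = \<nu>_c" using True by (simp add: single_sheet_def)
      ultimately show ?thesis by (simp only:)
    qed (simp add: single_sheet_def)
    moreover have "emeasure (\<nu>_d \<Otimes>\<^sub>M unit_lborel) (Inr -` ?X) = 0"
    proof -
      have "emeasure unit_lborel (Pair t -` Inr -` ?X) = 0" for t
      proof -
        have s: "Pair t -` Inr -` ?X \<subseteq> {z - 2 * real (e t)} \<inter> {0..1}"
          by (auto simp: J_def L_borel_def space_pair_measure space_restrict_space)
        have "emeasure unit_lborel (Pair t -` Inr -` ?X) \<le> emeasure unit_lborel ({z - 2 * real (e t)} \<inter> {0..1})"
          by (rule emeasure_mono[OF s]) (auto simp: sets_restrict_space_iff)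
        also have "\<dots> = emeasure lborel ({z - 2 * real (e t)} \<inter> {0..1})"
          by (rule emeasure_restrict_space) auto
        also have "\<dots> = 0" by (cases "z - 2 * real (e t) \<in> {0..1}") auto
        finally show ?thesis by simp
      qed
      then show ?thesis unfolding U.emeasure_pair_measure_alt[OF Xr] by (simp only:) simp
    qed
    ultimately show ?thesis using X \<open>Inl -` ?X \<in> _\<close> unfolding L_borel_def
      by (simp only: emeasure_disjoint_sum emeasure_disjoint_family_sum) simp
  qed
  show ?thesis by (rule that[OF Jm J'm AE null])
qed

text \<open>One code serves \<open>\<L>\<close> and \<open>\<L>\<^sub>*\<close>, because multiplication of the measure by \<open>t\<close> keeps null sets null.
The two normalisations of \<open>\<nu>\<close> say that both are probability spaces.\<close>

lemma single_sheet_iso_uniform01: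
  assumes sc: "sets \<nu>_c = sets Rpos" and "nonatomic \<nu>_c"
    and sd: "sets \<nu>_d = sets Rpos" and "discrete_measure \<nu>_d"
    and law: "total_measure (single_sheet \<nu>_c) \<nu>_d = \<nu>"
    and one: "emeasure \<nu> (space \<nu>) = 1" and mean: "(\<integral>\<^sup>+t. ennreal t \<partial>\<nu>) = 1"
  shows "\<exists>k k'. measure_preserving_iso (L_space (single_sheet \<nu>_c) \<nu>_d) (completion uniform01) k k'"
    and "\<exists>k k'. measure_preserving_iso (L_star_space (single_sheet \<nu>_c) \<nu>_d) (completion uniform01) k k'"
proof -
  let ?\<nu> = "single_sheet \<nu>_c"
  let ?L = "L_borel ?\<nu> \<nu>_d"
  let ?D = "density ?L (\<lambda>p. ennreal (t_coord p))"
  have s\<nu>: "sets (?\<nu> j) = sets Rpos" for j by (simp add: single_sheet_def sc)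
  note tm = measurable_t_coord[OF s\<nu> sd]
  have tb[measurable]: "t_coord \<in> borel_measurable ?L" using tm by (simp add: measurable_Rpos_iff)
  have d: "distr ?L Rpos t_coord = \<nu>" using distr_t_coord[OF s\<nu> sd] law by simp
  have "emeasure (distr ?L Rpos t_coord) (space (distr ?L Rpos t_coord)) = 1" unfolding d by (rule one)
  moreover have "t_coord -` space Rpos \<inter> space ?L = space ?L" using measurable_space[OF tm] by auto
  ultimately have p1: "prob_space ?L" 
    by (intro prob_spaceI) (simp add: emeasure_distr[OF tm sets.top] del: space_Rpos)
  have "(\<integral>\<^sup>+p. ennreal (t_coord p) \<partial>?L) = (\<integral>\<^sup>+t. ennreal t \<partial>distr ?L Rpos t_coord)"
    by (rule nn_integral_distr[symmetric, OF tm]) (simp add: measurable_Rpos_borel)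
  then have "(\<integral>\<^sup>+p. ennreal (t_coord p) \<partial>?L) = 1" by (simp only: d mean)
  then have p2: "prob_space ?D" by (intro prob_spaceI) (simp add: emeasure_density cong: nn_integral_cong)
  obtain J :: "nat \<times> real + real \<times> real \<Rightarrow> real" and J' where J: "J \<in> borel_measurable ?L" "J' \<in> measurable borel ?L"
    and AE: "AE p in ?L. J' (J p) = p" and null: "\<And>z. emeasure ?L (J -` {z} \<inter> space ?L) = 0"
    by (rule single_sheet_borel_code[OF assms(1-4)]) blast
  obtain u u' where "measure_preserving_iso ?L uniform01 u u'"
    by (rule mp_iso_of_borel_code[OF p1 J AE null])
  then show "\<exists>k k'. measure_preserving_iso (L_space ?\<nu> \<nu>_d) (completion uniform01) k k'"
    unfolding L_space_eq by (blast intro: mp_iso_completion)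
  have AE': "AE p in ?D. J' (J p) = p" using AE by (subst AE_density) (auto elim!: eventually_mono)
  have null': "emeasure ?D (J -` {z} \<inter> space ?D) = 0" for z
  proof -
    have "J -` {z} \<inter> space ?L \<in> null_sets ?L" using null[of z] measurable_sets[OF J(1), of "{z}"] by auto
    then have "AE p in ?L. p \<notin> J -` {z} \<inter> space ?L" and "J -` {z} \<inter> space ?L \<in> sets ?L"
      by (blast intro: AE_not_in, blast)
    then have "J -` {z} \<inter> space ?L \<in> null_sets ?D" 
      by (subst null_sets_density_iff) (measurable, auto elim: eventually_mono)
    then show ?thesis by auto
  qed
  have J2: "J \<in> borel_measurable ?D" "J' \<in> measurable borel ?D" using J by (auto simp: measurable_def)
  obtain v v' where "measure_preserving_iso ?D uniform01 v v'"
    by (rule mp_iso_of_borel_code[OF p2 J2 AE' null'])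
  then show "\<exists>k k'. measure_preserving_iso (L_star_space ?\<nu> \<nu>_d) (completion uniform01) k k'"
    unfolding L_star_space_eq[OF s\<nu> sd] by (blast intro: mp_iso_completion)
qed

section \<open>Derivatives of elements of the double cosets\<close>

lemma mp_iso_nn_integral:
  assumes f: "measure_preserving_iso N P f f'" and "h \<in> borel_measurable P"
  shows "(\<integral>\<^sup>+y. h y \<partial>P) = (\<integral>\<^sup>+x. h (f x) \<partial>N)"
proof -
  have "h \<in> borel_measurable (distr N P f)" using assms(2) by (simp only: mp_iso_distr[OF f])
  from nn_integral_distr[OF mp_iso_facts(1)[OF f] this] show ?thesis by (simp only: mp_iso_distr[OF f])
qed

lemma AE_nonsingular:
  assumes f: "f \<in> measurable M N" "\<And>A. A \<in> null_sets N \<Longrightarrow> f -` A \<inter> space M \<in> null_sets M"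
    and P: "AE y in N. P y"
  shows "AE x in M. P (f x)"
proof -
  obtain A where A: "A \<in> null_sets N" "{y \<in> space N. \<not> P y} \<subseteq> A"
    using P unfolding eventually_ae_filter by auto
  show ?thesis
    by (rule AE_I'[OF f(2)[OF A(1)]]) (use A(2) measurable_space[OF f(1)] in auto)
qed

lemma null_sets_vimage_AE:
  assumes "f \<in> measurable M N" "A \<in> null_sets N" "\<And>P. AE y in N. P y \<Longrightarrow> AE x in M. P (f x)"
  shows "f -` A \<inter> space M \<in> null_sets M"
proof -
  have "AE x in M. f x \<notin> A" using AE_not_in[OF assms(2)] by (rule assms(3))
  then have "AE x in M. x \<notin> f -` A \<inter> space M" by eventually_elim simp
  then show ?thesis
    by (rule AE_iff_null_sets[THEN iffD2, rotated]) (rule measurable_sets[OF assms(1) null_setsD2[OF assms(2)]])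
qed

text \<open>Both \<open>L\<close> and \<open>t L\<close> have the same null sets, as \<open>t > 0\<close>. The image of \<open>X\<close> under \<open>b\<^sup>-\<^sup>1 \<circ> a\<close> has the measure of
\<open>a X\<close> in \<open>t L\<close>, which is the integral of \<open>t \<circ> a\<close> over \<open>X\<close>.\<close>

lemma coset_map:
  assumes a: "measure_preserving_iso M L a a'"
    and b: "measure_preserving_iso M (density L (\<lambda>z. ennreal (t z))) b b'"
    and t: "t \<in> measurable L Rpos"
  shows "nonsingular_iso M M (b' \<circ> a) (a' \<circ> b)"
    and "distr M M (a' \<circ> b) = density M (\<lambda>x. ennreal (t (a x)))"
proof -
  let ?S = "density L (\<lambda>z. ennreal (t z))"
  note am = mp_iso_facts[OF a] and bm = mp_iso_facts[OF b]
  have tb[measurable]: "t \<in> borel_measurable L" using t by (simp add: measurable_Rpos_iff)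
  have tpos: "0 < t z" if "z \<in> space L" for z using measurable_space[OF t that] by simp
  have b'm: "b' \<in> measurable L M" and bm': "b \<in> measurable M L"
    using bm(1,2) by (auto simp: measurable_def)
  have SL: "(AE z in ?S. P z) \<longleftrightarrow> (AE z in L. P z)" for P
    by (subst AE_density) (auto intro!: AE_cong simp: tpos)
  have aAE: "AE x in M. P (a x)" if "AE z in L. P z" for P using mp_iso_AE[OF a that] .
  have a'AE: "AE z in L. P (a' z)" if "AE x in M. P x" for P using mp_iso_AE[OF mp_iso_sym[OF a] that] .
  have bAE: "AE x in M. P (b x)" if "AE z in L. P z" for P using mp_iso_AE[OF b] that by (simp add: SL)
  have b'AE: "AE z in L. P (b' z)" if "AE x in M. P x" for P using mp_iso_AE[OF mp_iso_sym[OF b] that] by (simp add: SL)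
  show "nonsingular_iso M M (b' \<circ> a) (a' \<circ> b)"
    unfolding nonsingular_iso_def inverse_mod0_def
  proof (intro conjI ballI)
    show m1: "b' \<circ> a \<in> measurable M M" by (rule measurable_comp[OF am(1) b'm])
    show m2: "a' \<circ> b \<in> measurable M M" by (rule measurable_comp[OF bm' am(2)])
    have "AE z in L. b (b' z) = z" using bm(4) by (simp only: SL)
    from aAE[OF this] am(3) show "AE x in M. (a' \<circ> b) ((b' \<circ> a) x) = x"
      by eventually_elim simp
    from bAE[OF am(4)] bm(3) show "AE x in M. (b' \<circ> a) ((a' \<circ> b) x) = x"
      by eventually_elim simp
    fix A assume A: "A \<in> null_sets M"
    show "(b' \<circ> a) -` A \<inter> space M \<in> null_sets M"
    proof (rule null_sets_vimage_AE[OF m1 A])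
      fix P assume "AE x in M. P x"
      from aAE[OF b'AE[OF this]] show "AE x in M. P ((b' \<circ> a) x)" by simp
    qed
    show "(a' \<circ> b) -` A \<inter> space M \<in> null_sets M"
    proof (rule null_sets_vimage_AE[OF m2 A])
      fix P assume "AE x in M. P x"
      from bAE[OF a'AE[OF this]] show "AE x in M. P ((a' \<circ> b) x)" by simp
    qed
  qed
  show "distr M M (a' \<circ> b) = density M (\<lambda>x. ennreal (t (a x)))"
  proof (rule measure_eqI)
    fix X assume "X \<in> sets (distr M M (a' \<circ> b))"
    then have X[measurable]: "X \<in> sets M" by simp
    note [measurable] = am(1,2)
    let ?Z = "a' -` X \<inter> space L"
    have Z[measurable]: "?Z \<in> sets L" by measurable
    have "emeasure (distr M M (a' \<circ> b)) X = emeasure M ((a' \<circ> b) -` X \<inter> space M)"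
      by (rule emeasure_distr[OF measurable_comp[OF bm' am(2)] X])
    also have "(a' \<circ> b) -` X \<inter> space M = b -` ?Z \<inter> space M" using measurable_space[OF bm'] by auto
    also have "emeasure M \<dots> = emeasure ?S ?Z" using Z by (intro bm(5)) simp
    also have "\<dots> = (\<integral>\<^sup>+z. ennreal (t z) * indicator ?Z z \<partial>L)" by (rule emeasure_density) measurable
    also have "\<dots> = (\<integral>\<^sup>+x. ennreal (t (a x)) * indicator ?Z (a x) \<partial>M)" 
      by (rule mp_iso_nn_integral[OF a]) measurable
    also have "\<dots> = (\<integral>\<^sup>+x. ennreal (t (a x)) * indicator X x \<partial>M)"
    proof (rule nn_integral_cong_AE)
      show "AE x in M. ennreal (t (a x)) * indicator ?Z (a x) = ennreal (t (a x)) * indicator X x"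
        using am(3) AE_space
        by eventually_elim (use measurable_space[OF am(1)] in \<open>auto simp: indicator_def\<close>)
    qed
    also have "\<dots> = emeasure (density M (\<lambda>x. ennreal (t (a x)))) X"
      by (rule emeasure_density[symmetric]) measurable
    finally show "emeasure (distr M M (a' \<circ> b)) X = emeasure (density M (\<lambda>x. ennreal (t (a x)))) X" .
  qed simp
qed

lemma nonsingular_inverse_unique:
  assumes g: "nonsingular_iso M M g g'" and h: "nonsingular_iso M M h h'" and gh: "AE x in M. g x = h x"
  shows "AE y in M. g' y = h' y"
proof -
  have g': "AE y in M. P (g' y)" if "AE x in M. P x" for P
    using g that unfolding nonsingular_iso_def inverse_mod0_def by (intro AE_nonsingular[of g']) auto
  have "AE y in M. g (g' y) = y" "AE x in M. h' (h x) = x"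
    using g h by (auto simp: nonsingular_iso_def inverse_mod0_def)
  then show ?thesis using g'[OF gh] g'[OF \<open>AE x in M. h' (h x) = x\<close>]
    by eventually_elim metis
qed

lemma gms_rel_class:
  assumes g: "nonsingular_iso M M g g'"
  shows "gms_rel M `` {g} \<in> Gms M"
    and "\<exists>h'. nonsingular_iso M M (SOME h. h \<in> gms_rel M `` {g}) h'"
    and "AE x in M. g x = (SOME h. h \<in> gms_rel M `` {g}) x"
proof -
  have gm: "g \<in> gms_maps M" using g by (auto simp: gms_maps_def)
  then show "gms_rel M `` {g} \<in> Gms M" unfolding Gms_def by (rule quotientI)
  have "g \<in> gms_rel M `` {g}" using gm by (simp add: gms_rel_def)
  then have "(SOME h. h \<in> gms_rel M `` {g}) \<in> gms_rel M `` {g}" 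
    by (rule someI[where P = "\<lambda>h. h \<in> gms_rel M `` {g}"])
  moreover have "(\<exists>h'. nonsingular_iso M M h h') \<and> (AE x in M. g x = h x)" if "h \<in> gms_rel M `` {g}" for h
    using that by (auto simp: gms_rel_def gms_maps_def)
  ultimately show "\<exists>h'. nonsingular_iso M M (SOME h. h \<in> gms_rel M `` {g}) h'"
    and "AE x in M. g x = (SOME h. h \<in> gms_rel M `` {g}) x"
    by blast+
qed

text \<open>The definition of \<open>\<kappa>\<close> chooses a representative of the class, then an inverse mod 0 and a
Radon-Nikodym derivative. All three are unique up to null sets, so any convenient triple
describes \<open>\<kappa>\<close>. Since \<open>D\<close> is positive everywhere, it is a map to \<open>\<real>\<^sup>\<times>\<close> without exceptions.\<close>

lemma kappa_eq_distr:
  assumes "prob_space M" and g: "nonsingular_iso M M g g'" and D: "D \<in> measurable M Rpos"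
    and dens: "distr M M g' = density M (\<lambda>x. ennreal (D x))"
    and A: "A \<in> sets M" and B: "B \<in> sets M"
  shows "kappa M (gms_rel M `` {g}) A B = distr (density M (indicator (A \<inter> g -` B))) Rpos D"
proof -
  interpret prob_space M by fact
  define h where "h = (SOME h. h \<in> gms_rel M `` {g})"
  define h' where "h' = (SOME h'. nonsingular_iso M M h h')"
  have "\<exists>h'. nonsingular_iso M M h h'" using gms_rel_class(2)[OF g] by (simp add: h_def)
  then have h: "nonsingular_iso M M h h'" unfolding h'_def by (rule someI_ex)
  have gh: "AE x in M. g x = h x" using gms_rel_class(3)[OF g] by (simp add: h_def)
  have hm[measurable]: "h \<in> measurable M M" "h' \<in> measurable M M" and gm[measurable]: "g \<in> measurable M M" "g' \<in> measurable M M"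
    using g h by (auto simp: nonsingular_iso_def inverse_mod0_def)
  have [measurable]: "D \<in> borel_measurable M" using D by (simp add: measurable_Rpos_iff)
  have Dpos: "0 < D x" if "x \<in> space M" for x using measurable_space[OF D that] by simp
  have "distr M M g' = distr M M h'"
    using nonsingular_inverse_unique[OF g h gh] by (intro distr_cong_AE) auto
  then have "AE x in M. ennreal (D x) = RN_deriv M (distr M M h') x"
    using dens by (intro RN_deriv_unique) auto
  then have deriv: "AE x in M. gms_deriv M h x = D x" using AE_space
  proof eventually_elim
    case (elim x)
    then show ?case unfolding gms_deriv_def h'_def[symmetric] elim(1)[symmetric]
      using Dpos[of x] by simp
  qed
  have derivm[measurable]: "gms_deriv M h \<in> borel_measurable M" unfolding gms_deriv_def by measurable
  have AgB: "A \<inter> g -` B \<in> sets M"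
  proof -
    have "A \<inter> g -` B = A \<inter> (g -` B \<inter> space M)" using sets.sets_into_space[OF A] by auto
    then show ?thesis using A measurable_sets[OF gm(1) B] by simp
  qed
  show ?thesis unfolding kappa_def kappa_map_def distr_def h_def[symmetric]
  proof (rule measure_of_eq[OF sets.space_closed])
    fix E assume "E \<in> sigma_sets (space Rpos) (sets Rpos)"
    then have E: "E \<in> sets Rpos" by (simp only: sets.sigma_sets_eq)
    then have Eb[measurable]: "E \<in> sets borel" by (simp add: sets_Rpos_iff)
    note [measurable] = A B
    have DE: "D -` E \<inter> space M \<in> sets M" by (rule measurable_sets[OF D E])
    have "emeasure (density M (indicator (A \<inter> g -` B))) (D -` E \<inter> space M) = 
        (\<integral>\<^sup>+x. indicator (A \<inter> g -` B) x * indicator (D -` E \<inter> space M) x \<partial>M)"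
      using AgB DE by (intro emeasure_density) auto
    also have "\<dots> = (\<integral>\<^sup>+x. indicator (A \<inter> g -` B \<inter> (D -` E \<inter> space M)) x \<partial>M)"
      unfolding indicator_inter_arith[symmetric] ..
    also have "\<dots> = emeasure M (A \<inter> g -` B \<inter> (D -` E \<inter> space M))"
      by (rule nn_integral_indicator[OF sets.Int[OF AgB DE]])
    also have "\<dots> = emeasure M {x \<in> A. h x \<in> B \<and> gms_deriv M h x \<in> E}"
    proof (rule emeasure_eq_AE)
      show "AE x in M. (x \<in> A \<inter> g -` B \<inter> (D -` E \<inter> space M)) = (x \<in> {x \<in> A. h x \<in> B \<and> gms_deriv M h x \<in> E})"
        using deriv gh AE_space by eventually_elim auto
      have "{x \<in> A. h x \<in> B \<and> gms_deriv M h x \<in> E} = {x \<in> space M. x \<in> A \<and> h x \<in> B \<and> gms_deriv M h x \<in> E}"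
        using sets.sets_into_space[OF A] by auto
      also have "\<dots> \<in> sets M" by measurable
      finally show "{x \<in> A. h x \<in> B \<and> gms_deriv M h x \<in> E} \<in> sets M" .
      show "A \<inter> g -` B \<inter> (D -` E \<inter> space M) \<in> sets M" using AgB DE by (rule sets.Int)
    qed
    finally show "emeasure M {x \<in> A. h x \<in> B \<and> gms_deriv M h x \<in> E} =
       emeasure (density M (indicator (A \<inter> g -` B))) (D -` E \<inter> space (density M (indicator (A \<inter> g -` B))))"
      by simp
  qed
qed

text \<open>The image measure under the inverse is \<open>A \<mapsto> \<mu>(gA)\<close>, hence \<open>D\<close> is a strictly positive version of \<open>g'\<close>.\<close>

definition has_gms_deriv :: "'a measure \<Rightarrow> ('a \<Rightarrow> 'a) \<Rightarrow> ('a \<Rightarrow> 'a) \<Rightarrow> ('a \<Rightarrow> real) \<Rightarrow> bool" where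
  "has_gms_deriv M g g' D \<longleftrightarrow> nonsingular_iso M M g g' \<and> D \<in> measurable M Rpos \<and>
     distr M M g' = density M (\<lambda>x. ennreal (D x))"

context prob_space begin

context
  fixes g g' D assumes gD: "has_gms_deriv M g g' D"
begin

lemma deriv_measurable: "D \<in> borel_measurable M" "D \<in> measurable M Rpos" "\<And>x. x \<in> space M \<Longrightarrow> 0 < D x"
  using gD by (auto simp: has_gms_deriv_def measurable_Rpos_iff)

lemma map_measurable: "g \<in> measurable M M" "g' \<in> measurable M M"
  using gD by (auto simp: has_gms_deriv_def nonsingular_iso_def inverse_mod0_def)

lemma deriv_nn_integral: 
  assumes X: "X \<in> sets M"
  shows "(\<integral>\<^sup>+x. ennreal (D x) * indicator X x \<partial>M) = emeasure M (g' -` X \<inter> space M)"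
proof -
  have "emeasure (distr M M g') X = (\<integral>\<^sup>+x. ennreal (D x) * indicator X x \<partial>M)"
    using gD X deriv_measurable(1) unfolding has_gms_deriv_def by (auto simp: emeasure_density)
  then show ?thesis using X map_measurable(2) by (simp add: emeasure_distr)
qed

lemma deriv_total: "(\<integral>\<^sup>+x. ennreal (D x) \<partial>M) = 1"
proof -
  have "(\<integral>\<^sup>+x. ennreal (D x) \<partial>M) = (\<integral>\<^sup>+x. ennreal (D x) * indicator (space M) x \<partial>M)"
    by (intro nn_integral_cong) simp
  also have "\<dots> = emeasure M (g' -` space M \<inter> space M)" by (rule deriv_nn_integral) simp
  also have "g' -` space M \<inter> space M = space M" using measurable_space[OF map_measurable(2)] by auto
  finally show ?thesis by (simp add: emeasure_space_1)
qed

lemma deriv_integrable: "integrable M D"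
  using deriv_total deriv_measurable by (intro integrableI_nonneg) (auto intro!: AE_I2 less_imp_le)

text \<open>Integrals against \<open>\<kappa>[g;A,B]\<close> and \<open>t\<kappa>[g;A,B]\<close> become integrals over \<open>M\<close>. In particular testing
\<open>t\<kappa>\<close> with \<open>\<psi>\<close> is testing \<open>\<kappa>\<close> with \<open>t \<psi>(t)\<close>, so that the two families of conditions in the topology can
be treated as one.\<close>

lemma kappa_of_gms_class:
  assumes A: "A \<in> sets M" and B: "B \<in> sets M"
  shows "kappa M (gms_rel M `` {g}) A B \<in> finite_measures_Rpos"
    and "times_t (kappa M (gms_rel M `` {g}) A B) \<in> finite_measures_Rpos"
    and "\<psi> \<in> borel_measurable Rpos \<Longrightarrow>
      (\<integral>t. \<psi> t \<partial>kappa M (gms_rel M `` {g}) A B) = (\<integral>x. indicat_real (A \<inter> g -` B) x * \<psi> (D x) \<partial>M)"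
    and "\<psi> \<in> borel_measurable Rpos \<Longrightarrow>
      (\<integral>t. \<psi> t \<partial>times_t (kappa M (gms_rel M `` {g}) A B)) = 
      (\<integral>x. indicat_real (A \<inter> g -` B) x * (D x * \<psi> (D x)) \<partial>M)"
proof -
  let ?k = "kappa M (gms_rel M `` {g}) A B"
  let ?d = "density M (indicator (A \<inter> g -` B))"
  have k: "?k = distr ?d Rpos D"
    using gD by (intro kappa_eq_distr[OF prob_space_axioms _ _ _ A B]) (auto simp: has_gms_deriv_def)
  note Dm = deriv_measurable(1,2)
  have AgB[measurable]: "A \<inter> g -` B \<in> sets M"
  proof -
    have "A \<inter> g -` B = A \<inter> (g -` B \<inter> space M)" using sets.sets_into_space[OF A] by auto
    then show ?thesis using A measurable_sets[OF map_measurable(1) B] by simp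
  qed
  have Dd: "D \<in> measurable ?d Rpos" using Dm by (auto simp: measurable_def)
  have sk: "sets ?k = sets Rpos" by (simp add: k)
  have spk: "space ?k = {0<..}" using sets_eq_imp_space_eq[OF sk] by simp
  have e1: "emeasure ?k (space ?k) \<le> 1"
  proof -
    have "emeasure ?k (space ?k) = emeasure ?d (D -` space Rpos \<inter> space ?d)"
      unfolding k space_distr by (rule emeasure_distr[OF Dd sets.top])
    also have "\<dots> \<le> emeasure ?d (space ?d)" by (rule emeasure_space)
    also have "\<dots> = emeasure M (A \<inter> g -` B)"
    proof -
      have "emeasure ?d (space M) = (\<integral>\<^sup>+x. indicator (A \<inter> g -` B) x \<partial>M)"
        by (subst emeasure_density) (auto intro!: nn_integral_cong)
      then show ?thesis by simp
    qed
    also have "\<dots> \<le> 1" by (rule emeasure_le_1)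
    finally show ?thesis .
  qed
  then show kf: "?k \<in> finite_measures_Rpos"
    unfolding finite_measures_Rpos_def by (auto simp: sk top_unique intro!: finite_measureI)
  have idm: "(\<lambda>t. ennreal t) \<in> borel_measurable ?k"
    unfolding measurable_cong_sets[OF sk refl] by (simp add: measurable_Rpos_borel)
  have "emeasure (times_t ?k) (space (times_t ?k)) = (\<integral>\<^sup>+t. ennreal t \<partial>?k)"
    unfolding times_t_def using idm by (simp add: emeasure_density cong: nn_integral_cong)
  also have "\<dots> = (\<integral>\<^sup>+x. ennreal (D x) \<partial>?d)"
    unfolding k by (rule nn_integral_distr[OF Dd]) (simp add: measurable_Rpos_borel)
  also have "\<dots> = (\<integral>\<^sup>+x. indicator (A \<inter> g -` B) x * ennreal (D x) \<partial>M)"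
    using Dm by (intro nn_integral_density) auto
  also have "\<dots> \<le> (\<integral>\<^sup>+x. ennreal (D x) \<partial>M)"
    by (intro nn_integral_mono) (auto simp: indicator_def)
  also have "\<dots> = 1" by (rule deriv_total)
  finally show "times_t ?k \<in> finite_measures_Rpos"
    unfolding finite_measures_Rpos_def by (auto simp: times_t_def sk top_unique intro!: finite_measureI)
  have int: "(\<integral>t. \<psi> t \<partial>?k) = (\<integral>x. indicat_real (A \<inter> g -` B) x * \<psi> (D x) \<partial>M)"
    if \<psi>: "\<psi> \<in> borel_measurable Rpos" for \<psi>
  proof -
    have "(\<integral>t. \<psi> t \<partial>?k) = (\<integral>x. \<psi> (D x) \<partial>?d)" unfolding k by (rule integral_distr[OF Dd \<psi>])
    also have "?d = density M (\<lambda>x. ennreal (indicat_real (A \<inter> g -` B) x))"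
      by (simp add: ennreal_indicator)
    also have "(\<integral>x. \<psi> (D x) \<partial>\<dots>) = (\<integral>x. indicat_real (A \<inter> g -` B) x *\<^sub>R \<psi> (D x) \<partial>M)"
      using measurable_compose[OF Dm(2) \<psi>] by (intro integral_density) auto
    finally show ?thesis by simp
  qed
  then show "\<psi> \<in> borel_measurable Rpos \<Longrightarrow> (\<integral>t. \<psi> t \<partial>?k) = (\<integral>x. indicat_real (A \<inter> g -` B) x * \<psi> (D x) \<partial>M)" .
  assume \<psi>: "\<psi> \<in> borel_measurable Rpos"
  have id: "(\<lambda>t::real. t) \<in> borel_measurable Rpos" by (rule measurable_Rpos_borel) simp
  have "(\<integral>t. \<psi> t \<partial>times_t ?k) = (\<integral>t. t *\<^sub>R \<psi> t \<partial>?k)" unfolding times_t_def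
  proof (rule integral_density)
    show "\<psi> \<in> borel_measurable ?k" "(\<lambda>t. t) \<in> borel_measurable ?k"
      using \<psi> id by (simp_all only: measurable_cong_sets[OF sk refl])
    show "AE t in ?k. 0 \<le> t" by (rule AE_I2) (simp add: spk)
  qed
  also have "\<dots> = (\<integral>x. indicat_real (A \<inter> g -` B) x * (D x * \<psi> (D x)) \<partial>M)"
    using id \<psi> by (subst int) auto
  finally show "(\<integral>t. \<psi> t \<partial>times_t ?k) = (\<integral>x. indicat_real (A \<inter> g -` B) x * (D x * \<psi> (D x)) \<partial>M)" .
qed

end

end

section \<open>The approximating element\<close>

lemma coset_has_gms_deriv:
  assumes a: "measure_preserving_iso M L a a'"
    and b: "measure_preserving_iso M (density L (\<lambda>z. ennreal (t z))) b b'"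
    and t: "t \<in> measurable L Rpos"
  shows "has_gms_deriv M (b' \<circ> a) (a' \<circ> b) (\<lambda>x. t (a x))"
  unfolding has_gms_deriv_def
  by (intro conjI coset_map[OF a b t] measurable_compose[OF mp_iso_facts(1)[OF a] t])

text \<open>Finitely many sets are coded by the binary digits of one index; its level sets are the cells of the
partition that they generate.\<close>

lemma finite_sets_index:
  assumes "finite \<B>" "\<B> \<subseteq> sets M"
  shows "\<exists>(\<iota> :: 'a \<Rightarrow> nat) m. \<iota> \<in> measurable M (count_space UNIV) \<and> (\<forall>y. \<iota> y < m) \<and>
    (\<forall>y y'. \<iota> y = \<iota> y' \<longrightarrow> (\<forall>B\<in>\<B>. y \<in> B \<longleftrightarrow> y' \<in> B))"
  using assms
proof induction
  case empty
  then show ?case by (intro exI[of _ "\<lambda>_. 0"] exI[of _ 1]) auto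
next
  case (insert B \<B>)
  then obtain \<iota> :: "'a \<Rightarrow> nat" and m where \<iota>: "\<iota> \<in> measurable M (count_space UNIV)" "\<And>y. \<iota> y < m"
    "\<And>y y'. \<iota> y = \<iota> y' \<Longrightarrow> (\<forall>B\<in>\<B>. y \<in> B \<longleftrightarrow> y' \<in> B)" by auto
  define \<rho> where "\<rho> y = 2 * \<iota> y + (if y \<in> B then 1 else 0)" for y
  have [measurable]: "B \<in> sets M" using insert.prems by simp
  note [measurable] = \<iota>(1)
  have "\<rho> \<in> measurable M (count_space UNIV)" unfolding \<rho>_def by measurable
  moreover have "\<rho> y < 2 * m" for y using \<iota>(2)[of y] by (auto simp: \<rho>_def)
  moreover have "\<forall>B'\<in>insert B \<B>. y \<in> B' \<longleftrightarrow> y' \<in> B'" if "\<rho> y = \<rho> y'" for y y'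
  proof -
    have "y \<in> B \<longleftrightarrow> y' \<in> B" using arg_cong[OF that, of even] unfolding \<rho>_def by (auto split: if_splits)
    moreover from this have "\<iota> y = \<iota> y'" using that by (auto simp: \<rho>_def split: if_splits)
    ultimately show ?thesis using \<iota>(3) by blast
  qed
  ultimately show ?case by blast
qed

text \<open>The index of \<open>t\<close> records the rounded values of finitely many functions; its level sets are the pieces
of the half-line on which all of them vary by at most \<open>\<delta>\<close>.\<close>

lemma finite_functions_index:
  fixes \<delta> :: real
  assumes "finite \<Psi>" "\<Psi> \<subseteq> borel_measurable Rpos" "0 < \<delta>"
  shows "\<exists>\<kappa> :: real \<Rightarrow> nat. \<kappa> \<in> measurable Rpos (count_space UNIV) \<and>
    (\<forall>s t. \<kappa> s = \<kappa> t \<longrightarrow> (\<forall>\<psi>\<in>\<Psi>. \<bar>\<psi> s - \<psi> t :: real\<bar> \<le> \<delta>))"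
  using assms(1,2)
proof induction
  case empty
  then show ?case by (intro exI[of _ "\<lambda>_. 0"]) auto
next
  case (insert \<psi> \<Psi>)
  then obtain \<kappa> :: "real \<Rightarrow> nat" where \<kappa>[measurable]: "\<kappa> \<in> measurable Rpos (count_space UNIV)"
    and \<kappa>2: "\<And>s t. \<kappa> s = \<kappa> t \<Longrightarrow> (\<forall>\<psi>\<in>\<Psi>. \<bar>\<psi> s - \<psi> t\<bar> \<le> \<delta>)" by auto
  have [measurable]: "\<psi> \<in> borel_measurable Rpos" using insert by auto
  have fl: "(\<lambda>t. \<lfloor>\<psi> t / \<delta>\<rfloor>) \<in> measurable Rpos (count_space UNIV)" by measurable
  have "(\<lambda>t. to_nat (n, \<lfloor>\<psi> t / \<delta>\<rfloor>)) \<in> measurable Rpos (count_space UNIV)" for n :: nat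
    by (rule measurable_compose[OF fl]) simp
  from measurable_compose_countable[OF this \<kappa>]
  have "(\<lambda>t. to_nat (\<kappa> t, \<lfloor>\<psi> t / \<delta>\<rfloor>)) \<in> measurable Rpos (count_space UNIV)" .
  moreover have "\<forall>\<phi>\<in>insert \<psi> \<Psi>. \<bar>\<phi> s - \<phi> t\<bar> \<le> \<delta>" 
    if "to_nat (\<kappa> s, \<lfloor>\<psi> s / \<delta>\<rfloor>) = to_nat (\<kappa> t, \<lfloor>\<psi> t / \<delta>\<rfloor>)" for s t
  proof -
    have eq: "\<kappa> s = \<kappa> t" "\<lfloor>\<psi> s / \<delta>\<rfloor> = \<lfloor>\<psi> t / \<delta>\<rfloor>" using that by auto
    have "\<bar>\<psi> s / \<delta> - \<psi> t / \<delta>\<bar> \<le> 1" using eq(2) by linarith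
    then have "\<bar>\<psi> s - \<psi> t\<bar> \<le> \<delta>" using \<open>0 < \<delta>\<close>
      by (simp add: diff_divide_distrib[symmetric] abs_divide divide_le_eq)
    then show ?thesis using \<kappa>2[OF eq(1)] by auto
  qed
  ultimately show ?case by blast
qed

lemma sets_index_neq:
  fixes i j :: "'a \<Rightarrow> nat"
  assumes [measurable]: "i \<in> measurable M (count_space UNIV)" "j \<in> measurable M (count_space UNIV)"
  shows "{x \<in> space M. i x \<noteq> j x} \<in> sets M"
proof -
  have "{x \<in> space M. i x \<noteq> j x} = {x \<in> space M. real (i x) < real (j x) \<or> real (j x) < real (i x)}"
    by auto
  also have "\<dots> \<in> sets M" by measurable
  finally show ?thesis .
qed

lemma small_mass_near_zero:
  assumes "finite_measure N" and sN: "sets N = sets Rpos" and "0 < \<eta>"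
  shows "\<exists>s>0. measure N {0<..<s} < \<eta>"
proof -
  interpret finite_measure N by fact
  let ?I = "\<lambda>n. {0<..<1 / real (Suc n)}"
  have "(\<lambda>n. measure N (?I n)) \<longlonglongrightarrow> measure N (\<Inter>n. ?I n)"
  proof (rule finite_Lim_measure_decseq)
    show "range ?I \<subseteq> sets N" unfolding sN by (auto simp: sets_Rpos_iff)
    show "decseq ?I" unfolding decseq_def
    proof (intro allI impI)
      fix m n :: nat assume "m \<le> n"
      then have "1 / real (Suc n) \<le> 1 / real (Suc m)" by (intro frac_le) auto
      then show "?I n \<subseteq> ?I m" by (auto simp del: of_nat_Suc)
    qed
  qed
  moreover have "(\<Inter>n. ?I n) = {}"
  proof (rule equals0I)
    fix x assume "x \<in> (\<Inter>n. ?I n)"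
    then have x: "x \<in> ?I n" for n by blast
    then have "0 < x" by simp
    then obtain n where "1 / real (Suc n) < x" by (rule nat_approx_posE)
    with x[of n] show False by simp
  qed
  ultimately have "(\<lambda>n. measure N (?I n)) \<longlonglongrightarrow> 0" by simp
  then have "\<forall>\<^sub>F n in sequentially. measure N (?I n) < \<eta>" using \<open>0 < \<eta>\<close> by (rule order_tendstoD)
  then obtain n where "measure N (?I n) < \<eta>" by (auto simp: eventually_sequentially)
  then show ?thesis by (intro exI[of _ "1 / real (Suc n)"]) auto
qed

context prob_space begin

lemma AE_index_eq:
  fixes i j :: "'a \<Rightarrow> nat"
  assumes [measurable]: "i \<in> measurable M (count_space UNIV)" "j \<in> measurable M (count_space UNIV)"
    and 0: "\<And>k. measure M {x \<in> space M. (i x \<le> k) \<noteq> (j x \<le> k)} = 0"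
  shows "AE x in M. i x = j x"
proof -
  have "AE x in M. (i x \<le> k) \<longleftrightarrow> (j x \<le> k)" for k
  proof -
    have "{x \<in> space M. (i x \<le> k) \<noteq> (j x \<le> k)} \<in> null_sets M"
      using 0[of k] by (intro null_setsI) (auto simp: emeasure_eq_measure)
    then show ?thesis by (rule AE_I') auto
  qed
  then have "AE x in M. \<forall>k. (i x \<le> k) \<longleftrightarrow> (j x \<le> k)" by (simp add: AE_all_countable)
  then show ?thesis by eventually_elim (meson order_antisym order_refl)
qed

text \<open>If two indices below \<open>m\<close> differ, then the smaller one separates them.\<close>

lemma measure_index_neq_le:
  fixes i j :: "'a \<Rightarrow> nat"
  assumes [measurable]: "i \<in> measurable M (count_space UNIV)" "j \<in> measurable M (count_space UNIV)"
    and m: "\<And>x. x \<in> space M \<Longrightarrow> i x < m" "\<And>x. x \<in> space M \<Longrightarrow> j x < m" 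
    and le: "\<And>k. measure M {x \<in> space M. (i x \<le> k) \<noteq> (j x \<le> k)} \<le> \<delta>"
  shows "measure M {x \<in> space M. i x \<noteq> j x} \<le> real m * \<delta>"
proof -
  have "{x \<in> space M. i x \<noteq> j x} \<subseteq> (\<Union>k<m. {x \<in> space M. (i x \<le> k) \<noteq> (j x \<le> k)})"
  proof
    fix x assume x: "x \<in> {x \<in> space M. i x \<noteq> j x}"
    have "min (i x) (j x) < m" "(i x \<le> min (i x) (j x)) \<noteq> (j x \<le> min (i x) (j x))"
      using x m[of x] by (auto simp: min_def)
    with x show "x \<in> (\<Union>k<m. {x \<in> space M. (i x \<le> k) \<noteq> (j x \<le> k)})" by blast
  qed
  then have "measure M {x \<in> space M. i x \<noteq> j x} \<le> measure M (\<Union>k<m. {x \<in> space M. (i x \<le> k) \<noteq> (j x \<le> k)})"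
    by (intro finite_measure_mono) auto
  also have "\<dots> \<le> (\<Sum>k<m. measure M {x \<in> space M. (i x \<le> k) \<noteq> (j x \<le> k)})"
    by (intro finite_measure_subadditive_finite) auto
  also have "\<dots> \<le> (\<Sum>k<m. \<delta>)" by (intro sum_mono le)
  finally show ?thesis by simp
qed

text \<open>This is \<open>\<mu>(gX) = \<integral>\<^sub>X g'\<close> for \<open>X = g\<^sup>-\<^sup>1 Y\<close>.\<close>

lemma deriv_measure_image:
  assumes g: "has_gms_deriv M g g' D" and Y: "Y \<in> sets M"
  shows "measure M Y = (\<integral>x. indicat_real (g -` Y \<inter> space M) x * D x \<partial>M)"
proof -
  note [measurable] = map_measurable[OF g] deriv_measurable(1)[OF g] Y
  have gY: "g -` Y \<inter> space M \<in> sets M" by measurable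
  have "AE y in M. g (g' y) = y" using g by (auto simp: has_gms_deriv_def nonsingular_iso_def inverse_mod0_def)
  then have "emeasure M Y = emeasure M (g' -` (g -` Y \<inter> space M) \<inter> space M)"
  proof (intro emeasure_eq_AE)
    assume "AE y in M. g (g' y) = y"
    then show "AE y in M. (y \<in> Y) = (y \<in> g' -` (g -` Y \<inter> space M) \<inter> space M)"
      using AE_space by eventually_elim (use measurable_space[OF map_measurable(2)[OF g]] in auto)
  qed measurable
  also have "\<dots> = (\<integral>\<^sup>+x. ennreal (D x) * indicator (g -` Y \<inter> space M) x \<partial>M)"
    by (rule deriv_nn_integral[OF g gY, symmetric])
  also have "\<dots> = (\<integral>\<^sup>+x. ennreal (indicat_real (g -` Y \<inter> space M) x * D x) \<partial>M)"
    by (intro nn_integral_cong) (auto simp: indicator_def)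
  also have "\<dots> = ennreal (\<integral>x. indicat_real (g -` Y \<inter> space M) x * D x \<partial>M)"
  proof (rule nn_integral_eq_integral)
    show "integrable M (\<lambda>x. indicat_real (g -` Y \<inter> space M) x * D x)" 
      using integrable_mult_indicator[OF gY deriv_integrable[OF g]] by (simp only: real_scaleR_def)
    show "AE x in M. 0 \<le> indicat_real (g -` Y \<inter> space M) x * D x"
      using deriv_measurable(3)[OF g] by (intro AE_I2) (simp add: indicator_def less_imp_le)
  qed
  finally show ?thesis
    using deriv_measurable(3)[OF g] 
    by (subst (asm) emeasure_eq_measure) (auto intro!: integral_nonneg_AE AE_I2 simp: indicator_def less_imp_le)
qed

text \<open>The map \<open>a\<close> matches the pieces \<open>\<kappa>\<close> of the values of \<open>D\<close> with those of \<open>t\<close>; their masses agree by the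
equality of laws, so the match is exact. The map \<open>b\<close> matches the cells \<open>\<iota>\<close> of \<open>M\<close> with their
transports \<open>a (g\<^sup>-\<^sup>1 Y)\<close>, whose masses in \<open>t L\<close> are off by at most \<open>\<delta>\<close> for each initial union of cells.
Hence \<open>\<iota> y\<close> and \<open>\<iota> (g (h\<^sup>-\<^sup>1 y))\<close> disagree on a set of measure at most \<open>m \<delta>\<close>, and the
substitution \<open>y = h x\<close> turns this into the last estimate, with the derivative of \<open>h\<close> as a weight.\<close>

lemma approximating_coset_element:
  fixes L :: "'b measure" and \<iota> :: "'a \<Rightarrow> nat" and \<kappa> :: "real \<Rightarrow> nat"
  assumes std: "measure_preserving_iso M (completion uniform01) w w'"
    and g: "has_gms_deriv M g g' D"
    and t: "t \<in> measurable L Rpos"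
    and L: "measure_preserving_iso L (completion uniform01) k k'"
    and Ls: "measure_preserving_iso (density L (\<lambda>z. ennreal (t z))) (completion uniform01) q q'"
    and law: "distr L Rpos t = distr M Rpos D"
    and \<kappa>: "\<kappa> \<in> measurable Rpos (count_space UNIV)" "\<And>r s. \<kappa> r = \<kappa> s \<Longrightarrow> \<bar>r - s\<bar> \<le> \<delta>"
    and \<iota>: "\<iota> \<in> measurable M (count_space UNIV)" "\<And>y. \<iota> y < m"
  obtains a a' b b' where "measure_preserving_iso M L a a'"
    "measure_preserving_iso M (density L (\<lambda>z. ennreal (t z))) b b'"
    "AE x in M. \<kappa> (t (a x)) = \<kappa> (D x)"
    "(\<integral>x. indicat_real {x \<in> space M. \<iota> (b' (a x)) \<noteq> \<iota> (g x)} x * t (a x) \<partial>M) \<le> real m * \<delta>"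
proof -
  let ?S = "density L (\<lambda>z. ennreal (t z))"
  note Dm = deriv_measurable(2)[OF g] and gm[measurable] = map_measurable[OF g]
  have \<kappa>D[measurable]: "(\<lambda>x. \<kappa> (D x)) \<in> measurable M (count_space UNIV)" by (rule measurable_compose[OF Dm \<kappa>(1)])
  have \<kappa>t[measurable]: "(\<lambda>z. \<kappa> (t z)) \<in> measurable L (count_space UNIV)" by (rule measurable_compose[OF t \<kappa>(1)])
  obtain a a' where a: "measure_preserving_iso M L a a'"
    and a2: "\<And>j. measure M {x \<in> space M. (\<kappa> (D x) \<le> j) \<noteq> (\<kappa> (t (a x)) \<le> j)}
       = \<bar>measure M {x \<in> space M. \<kappa> (D x) \<le> j} - measure L {z \<in> space L. \<kappa> (t z) \<le> j}\<bar>"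
    by (rule iso_matching_indices[OF std L \<kappa>D \<kappa>t]) blast
  have "measure M {x \<in> space M. \<kappa> (D x) \<le> j} = measure L {z \<in> space L. \<kappa> (t z) \<le> j}" for j
  proof -
    have E: "{s \<in> space Rpos. \<kappa> s \<le> j} \<in> sets Rpos" using \<kappa>(1) by measurable
    have "{x \<in> space M. \<kappa> (D x) \<le> j} = D -` {s \<in> space Rpos. \<kappa> s \<le> j} \<inter> space M"
      using measurable_space[OF Dm] by auto
    moreover have "{z \<in> space L. \<kappa> (t z) \<le> j} = t -` {s \<in> space Rpos. \<kappa> s \<le> j} \<inter> space L"
      using measurable_space[OF t] by auto
    ultimately show ?thesis 
      using measure_distr[OF Dm E] measure_distr[OF t E] law by simp
  qed
  then have "AE x in M. \<kappa> (D x) = \<kappa> (t (a x))"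
    using a2 measurable_compose[OF mp_iso_facts(1)[OF a] \<kappa>t] by (intro AE_index_eq) auto
  then have \<kappa>eq: "AE x in M. \<kappa> (t (a x)) = \<kappa> (D x)" by eventually_elim simp
  note [measurable] = mp_iso_facts(1,2)[OF a] \<iota>(1)
  \<comment> \<open>The cell of \<open>z\<close> in the transported partition: its preimage under \<open>a\<close> is moved by \<open>g\<close>.\<close>
  define idx where "idx z = \<iota> (g (a' z))" for z
  have idxL: "idx \<in> measurable L (count_space UNIV)" unfolding idx_def
    by (rule measurable_compose[OF mp_iso_facts(2)[OF a] measurable_compose[OF gm(1) \<iota>(1)]])
  then have idxm: "idx \<in> measurable ?S (count_space UNIV)" by (simp add: measurable_def)
  obtain b b' where b: "measure_preserving_iso M ?S b b'"
    and b2: "\<And>j. measure M {y \<in> space M. (\<iota> y \<le> j) \<noteq> (idx (b y) \<le> j)}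
       = \<bar>measure M {y \<in> space M. \<iota> y \<le> j} - measure ?S {z \<in> space ?S. idx z \<le> j}\<bar>"
    by (rule iso_matching_indices[OF std Ls \<iota>(1) idxm]) blast
  define h where "h = b' \<circ> a"
  define h' where "h' = a' \<circ> b"
  define Dh where "Dh x = t (a x)" for x
  have h: "has_gms_deriv M h h' Dh" unfolding h_def h'_def Dh_def by (rule coset_has_gms_deriv[OF a b t])
  note hm[measurable] = map_measurable[OF h]
  have tb[measurable]: "t \<in> borel_measurable L" using t by (simp add: measurable_Rpos_iff)
  have D_close: "AE x in M. \<bar>D x - Dh x\<bar> \<le> \<delta>" using \<kappa>eq
    by eventually_elim (simp add: \<kappa>(2) Dh_def abs_minus_commute)
  have close: "\<bar>measure M {y \<in> space M. \<iota> y \<le> j} - measure ?S {z \<in> space ?S. idx z \<le> j}\<bar> \<le> \<delta>" for j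
  proof -
    let ?Y = "{y \<in> space M. \<iota> y \<le> j}" and ?Z = "{z \<in> space L. idx z \<le> j}"
    let ?X = "g -` ?Y \<inter> space M"
    have Y[measurable]: "?Y \<in> sets M" by measurable
    have X[measurable]: "?X \<in> sets M" by measurable
    have Z[measurable]: "?Z \<in> sets L" using idxL by measurable
    have iD: "integrable M (\<lambda>x. indicat_real ?X x * D x)" 
      using integrable_mult_indicator[OF X deriv_integrable[OF g]] by (simp only: real_scaleR_def)
    have iDh: "integrable M (\<lambda>x. indicat_real ?X x * Dh x)" 
      using integrable_mult_indicator[OF X deriv_integrable[OF h]] by (simp only: real_scaleR_def)
    have Dhpos: "0 < Dh x" if "x \<in> space M" for x using deriv_measurable(3)[OF h that] .
    have 1: "measure M ?Y = (\<integral>x. indicat_real ?X x * D x \<partial>M)" by (rule deriv_measure_image[OF g Y])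
    have "emeasure ?S ?Z = (\<integral>\<^sup>+z. ennreal (t z) * indicator ?Z z \<partial>L)" by (rule emeasure_density) measurable
    also have "\<dots> = (\<integral>\<^sup>+x. ennreal (Dh x) * indicator ?Z (a x) \<partial>M)" unfolding Dh_def
      by (rule mp_iso_nn_integral[OF a]) measurable
    also have "\<dots> = (\<integral>\<^sup>+x. ennreal (indicat_real ?X x * Dh x) \<partial>M)"
    proof (rule nn_integral_cong_AE)
      show "AE x in M. ennreal (Dh x) * indicator ?Z (a x) = ennreal (indicat_real ?X x * Dh x)"
        using mp_iso_facts(3)[OF a] AE_space
        by eventually_elim
          (use measurable_space[OF mp_iso_facts(1)[OF a]] measurable_space[OF gm(1)] in \<open>auto simp: indicator_def idx_def\<close>)
    qed
    also have "\<dots> = ennreal (\<integral>x. indicat_real ?X x * Dh x \<partial>M)"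
      using Dhpos by (intro nn_integral_eq_integral iDh) (auto intro!: AE_I2 simp: indicator_def less_imp_le)
    finally have 2: "measure ?S {z \<in> space ?S. idx z \<le> j} = (\<integral>x. indicat_real ?X x * Dh x \<partial>M)"
      using Dhpos unfolding measure_def
      by (auto intro!: integral_nonneg_AE AE_I2 enn2real_ennreal simp: indicator_def less_imp_le)
    have "\<bar>measure M ?Y - measure ?S {z \<in> space ?S. idx z \<le> j}\<bar> = 
        \<bar>\<integral>x. indicat_real ?X x * D x - indicat_real ?X x * Dh x \<partial>M\<bar>"
      unfolding 1 2 by (simp only: Bochner_Integration.integral_diff[OF iD iDh])
    also have "\<dots> \<le> (\<integral>x. \<bar>indicat_real ?X x * D x - indicat_real ?X x * Dh x\<bar> \<partial>M)"
      by (rule integral_abs_bound)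
    also have "\<dots> \<le> (\<integral>x. \<delta> \<partial>M)"
    proof (rule integral_mono_AE)
      show "integrable M (\<lambda>x. \<bar>indicat_real ?X x * D x - indicat_real ?X x * Dh x\<bar>)"
        using iD iDh by auto
      show "AE x in M. \<bar>indicat_real ?X x * D x - indicat_real ?X x * Dh x\<bar> \<le> \<delta>"
        using D_close by eventually_elim (auto simp: indicator_def)
    qed simp
    also have "\<dots> = \<delta>" by (simp add: prob_space)
    finally show ?thesis .
  qed
  let ?i = "\<lambda>y. \<iota> (g (h' y))"
  have idx_h': "idx (b y) = ?i y" for y by (simp add: idx_def h'_def)
  have im[measurable]: "?i \<in> measurable M (count_space UNIV)"
    by (rule measurable_compose[OF hm(2) measurable_compose[OF gm(1) \<iota>(1)]])
  have le1: "measure M {y \<in> space M. \<iota> y \<noteq> ?i y} \<le> real m * \<delta>"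
    using b2 close by (intro measure_index_neq_le \<iota> im) (simp add: idx_h')
  let ?E = "{x \<in> space M. \<iota> (h x) \<noteq> \<iota> (g x)}"
  have \<iota>h[measurable]: "(\<lambda>x. \<iota> (h x)) \<in> measurable M (count_space UNIV)" by (rule measurable_compose[OF hm(1) \<iota>(1)])
  have \<iota>g[measurable]: "(\<lambda>x. \<iota> (g x)) \<in> measurable M (count_space UNIV)" by (rule measurable_compose[OF gm(1) \<iota>(1)])
  have E: "?E \<in> sets M" by (rule sets_index_neq[OF \<iota>h \<iota>g])
  have "ennreal (\<integral>x. indicat_real ?E x * Dh x \<partial>M) = (\<integral>\<^sup>+x. ennreal (indicat_real ?E x * Dh x) \<partial>M)"
  proof (rule nn_integral_eq_integral[symmetric])
    show "integrable M (\<lambda>x. indicat_real ?E x * Dh x)" 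
      using integrable_mult_indicator[OF E deriv_integrable[OF h]] by (simp only: real_scaleR_def)
    show "AE x in M. 0 \<le> indicat_real ?E x * Dh x" 
      using deriv_measurable(3)[OF h] by (auto intro!: AE_I2 simp: indicator_def less_imp_le)
  qed
  also have "\<dots> = (\<integral>\<^sup>+x. ennreal (Dh x) * indicator ?E x \<partial>M)"
    by (intro nn_integral_cong) (auto simp: indicator_def)
  also have "\<dots> = emeasure M (h' -` ?E \<inter> space M)" by (rule deriv_nn_integral[OF h E])
  also have "\<dots> = emeasure M {y \<in> space M. \<iota> y \<noteq> ?i y}"
  proof (rule emeasure_eq_AE)
    have "AE y in M. h (h' y) = y" using h by (auto simp: has_gms_deriv_def nonsingular_iso_def inverse_mod0_def)
    then show "AE y in M. (y \<in> h' -` ?E \<inter> space M) = (y \<in> {y \<in> space M. \<iota> y \<noteq> ?i y})"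
      using AE_space by eventually_elim (use measurable_space[OF hm(2)] in auto)
  qed (rule measurable_sets[OF hm(2) E], rule sets_index_neq[OF \<iota>(1) im])
  also have "\<dots> \<le> ennreal (real m * \<delta>)" unfolding emeasure_eq_measure by (rule ennreal_leI[OF le1])
  finally have "ennreal (\<integral>x. indicat_real ?E x * Dh x \<partial>M) \<le> ennreal (real m * \<delta>)" .
  moreover have "0 \<le> real m * \<delta>" by (rule order_trans[OF measure_nonneg le1])
  ultimately have "(\<integral>x. indicat_real ?E x * Dh x \<partial>M) \<le> real m * \<delta>"
    using ennreal_le_iff by blast
  then show ?thesis using that[OF a b \<kappa>eq] by (simp add: h_def Dh_def)
qed

end

section \<open>From open sets to finitely many tests\<close>

text \<open>If every subbasic set contains with each point a neighbourhood cut out by finitely many of the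
functions \<open>I \<tau>\<close>, then so does every open set. It is used for the weak topology and for \<open>Gms\<close>.\<close>

lemma generated_topology_tests:
  fixes I :: "'t \<Rightarrow> 'x \<Rightarrow> real"
  assumes gen: "generate_topology_on \<S> W"
    and basis: "\<And>s x. s \<in> \<S> \<Longrightarrow> x \<in> s \<Longrightarrow> x \<in> X \<Longrightarrow>
      \<exists>F \<epsilon>. finite F \<and> F \<subseteq> T \<and> 0 < \<epsilon> \<and> (\<forall>y\<in>X. (\<forall>\<tau>\<in>F. \<bar>I \<tau> y - I \<tau> x\<bar> < \<epsilon>) \<longrightarrow> y \<in> s)"
    and x: "x \<in> W" "x \<in> X"
  shows "\<exists>F \<epsilon>. finite F \<and> F \<subseteq> T \<and> 0 < \<epsilon> \<and> (\<forall>y\<in>X. (\<forall>\<tau>\<in>F. \<bar>I \<tau> y - I \<tau> x\<bar> < \<epsilon>) \<longrightarrow> y \<in> W)"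
  using gen x(1)
proof induction
  case (Int U V)
  then have U: "x \<in> U" and V: "x \<in> V" by auto
  obtain F \<epsilon> where F: "finite F" "F \<subseteq> T" "0 < \<epsilon>" "\<And>y. y \<in> X \<Longrightarrow> (\<forall>\<tau>\<in>F. \<bar>I \<tau> y - I \<tau> x\<bar> < \<epsilon>) \<Longrightarrow> y \<in> U"
    using Int.IH(1)[OF U] by auto
  obtain G \<delta> where G: "finite G" "G \<subseteq> T" "0 < \<delta>" "\<And>y. y \<in> X \<Longrightarrow> (\<forall>\<tau>\<in>G. \<bar>I \<tau> y - I \<tau> x\<bar> < \<delta>) \<Longrightarrow> y \<in> V"
    using Int.IH(2)[OF V] by auto
  show ?case
  proof (intro exI conjI ballI impI)
    show "finite (F \<union> G)" "F \<union> G \<subseteq> T" "0 < min \<epsilon> \<delta>" using F G by auto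
    fix y assume y: "y \<in> X" "\<forall>\<tau>\<in>F \<union> G. \<bar>I \<tau> y - I \<tau> x\<bar> < min \<epsilon> \<delta>"
    have "y \<in> U" by (rule F(4)[OF y(1)]) (use y(2) in auto)
    moreover have "y \<in> V" by (rule G(4)[OF y(1)]) (use y(2) in auto)
    ultimately show "y \<in> U \<inter> V" by simp
  qed
next
  case (UN K)
  then obtain k where k: "k \<in> K" "x \<in> k" by auto
  from UN.IH[OF k] show ?case using k(1) by (meson UnionI)
next
  case (Basis s)
  then show ?case using basis x(2) by blast
qed simp

definition weak_tests :: "(real \<Rightarrow> real) set" where
  "weak_tests = {\<phi>. continuous_on {0<..} \<phi> \<and> bounded (\<phi> ` {0<..})}"

lemma weak_topology_tests:
  assumes "openin weak_topology_Rpos U" "N \<in> U" "N \<in> finite_measures_Rpos"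
  shows "\<exists>F \<epsilon>. finite F \<and> F \<subseteq> weak_tests \<and> 0 < \<epsilon> \<and>
    (\<forall>N'\<in>finite_measures_Rpos. (\<forall>\<phi>\<in>F. \<bar>(\<integral>t. \<phi> t \<partial>N') - (\<integral>t. \<phi> t \<partial>N)\<bar> < \<epsilon>) \<longrightarrow> N' \<in> U)"
proof (rule generated_topology_tests[where I = "\<lambda>\<phi> N. \<integral>t. \<phi> t \<partial>N"])
  show "generate_topology_on {{N \<in> finite_measures_Rpos. (\<integral>t. \<phi> t \<partial>N) \<in> V} | (\<phi> :: real \<Rightarrow> real) V.
        continuous_on {0<..} \<phi> \<and> bounded (\<phi> ` {0<..}) \<and> open V} U"
    using assms(1) by (simp only: weak_topology_Rpos_def openin_topology_generated_by_iff)
  fix s N assume s: "s \<in> {{N \<in> finite_measures_Rpos. (\<integral>t. \<phi> t \<partial>N) \<in> V} | (\<phi> :: real \<Rightarrow> real) V.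
        continuous_on {0<..} \<phi> \<and> bounded (\<phi> ` {0<..}) \<and> open V}" and N: "N \<in> s"
  then obtain \<phi> :: "real \<Rightarrow> real" and V where \<phi>: "\<phi> \<in> weak_tests" "open V"
    and s_eq: "s = {N \<in> finite_measures_Rpos. (\<integral>t. \<phi> t \<partial>N) \<in> V}" by (auto simp: weak_tests_def)
  have "(\<integral>t. \<phi> t \<partial>N) \<in> V" using N s_eq by auto
  then obtain \<epsilon> where "0 < \<epsilon>" and \<epsilon>: "\<And>y. dist y (\<integral>t. \<phi> t \<partial>N) < \<epsilon> \<Longrightarrow> y \<in> V"
    using \<open>open V\<close> unfolding open_dist by blast
  show "\<exists>F \<epsilon>. finite F \<and> F \<subseteq> weak_tests \<and> 0 < \<epsilon> \<and>
    (\<forall>N'\<in>finite_measures_Rpos. (\<forall>\<phi>\<in>F. \<bar>(\<integral>t. \<phi> t \<partial>N') - (\<integral>t. \<phi> t \<partial>N)\<bar> < \<epsilon>) \<longrightarrow> N' \<in> s)"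
    using \<phi> \<open>0 < \<epsilon>\<close> \<epsilon> by (intro exI[of _ "{\<phi>}"] exI[of _ \<epsilon>]) (auto simp: s_eq dist_real_def)
qed (use assms in auto)

text \<open>Functions of linear growth include the bounded functions \<open>\<phi>\<close>, which test \<open>\<kappa>\<close>, as well as \<open>t \<phi>(t)\<close>, which
represent the tests for \<open>t\<kappa>\<close>.\<close>

definition kappa_tests :: "'a measure \<Rightarrow> ('a set \<times> 'a set \<times> (real \<Rightarrow> real)) set" where
  "kappa_tests M = {(A, B, \<psi>). A \<in> sets M \<and> B \<in> sets M \<and> \<psi> \<in> borel_measurable Rpos \<and>
     (\<exists>K\<ge>0. \<forall>t>0. \<bar>\<psi> t\<bar> \<le> K * (1 + t))}"

definition kappa_integral :: "'a measure \<Rightarrow> 'a set \<times> 'a set \<times> (real \<Rightarrow> real) \<Rightarrow> ('a \<Rightarrow> 'a) set \<Rightarrow> real" where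
  "kappa_integral M = (\<lambda>(A, B, \<psi>) c. \<integral>t. \<psi> t \<partial>kappa M c A B)"

text \<open>Classes that come with a representative, an inverse and a positive derivative. All double cosets
consist of such classes, and only these have to be compared.\<close>

definition gms_classes :: "'a measure \<Rightarrow> ('a \<Rightarrow> 'a) set set" where
  "gms_classes M = {gms_rel M `` {g} | g. \<exists>g' D. has_gms_deriv M g g' D}"

lemma weak_tests_measurable: "\<phi> \<in> weak_tests \<Longrightarrow> \<phi> \<in> borel_measurable Rpos"
  unfolding Rpos_def weak_tests_def by (auto intro: borel_measurable_continuous_on_restrict)

lemma weak_tests_bounded:
  assumes "\<phi> \<in> weak_tests"
  obtains K where "0 \<le> K" "\<And>t. 0 < t \<Longrightarrow> \<bar>\<phi> t\<bar> \<le> K"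
proof -
  obtain K where "\<And>t. 0 < t \<Longrightarrow> \<bar>\<phi> t\<bar> \<le> K"
    using assms unfolding weak_tests_def bounded_iff by auto
  then have "\<And>t. 0 < t \<Longrightarrow> \<bar>\<phi> t\<bar> \<le> max 0 K" by (meson max.coboundedI2)
  then show ?thesis by (rule that[OF max.cobounded1])
qed

context prob_space begin

lemma Gms_topology_tests:
  assumes W: "openin (Gms_topology M) W" and c: "c \<in> W" "c \<in> gms_classes M"
  shows "\<exists>F \<epsilon>. finite F \<and> F \<subseteq> kappa_tests M \<and> 0 < \<epsilon> \<and>
    (\<forall>c'\<in>gms_classes M. (\<forall>\<tau>\<in>F. \<bar>kappa_integral M \<tau> c' - kappa_integral M \<tau> c\<bar> < \<epsilon>) \<longrightarrow> c' \<in> W)"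
proof -
  let ?S1 = "{{c \<in> Gms M. kappa M c A B \<in> U} | A B U.
         A \<in> sets M \<and> B \<in> sets M \<and> openin weak_topology_Rpos U}"
  let ?S2 = "{{c \<in> Gms M. times_t (kappa M c A B) \<in> U} | A B U.
         A \<in> sets M \<and> B \<in> sets M \<and> openin weak_topology_Rpos U}"
  have Gms: "c \<in> Gms M" if "c \<in> gms_classes M" for c
    using that gms_rel_class(1) by (auto simp: gms_classes_def has_gms_deriv_def)
  have fin: "kappa M c A B \<in> finite_measures_Rpos" "times_t (kappa M c A B) \<in> finite_measures_Rpos"
    if "c \<in> gms_classes M" "A \<in> sets M" "B \<in> sets M" for c A B
    using that kappa_of_gms_class(1,2) by (auto simp: gms_classes_def)
  have times: "(\<integral>t. \<phi> t \<partial>times_t (kappa M c A B)) = kappa_integral M (A, B, \<lambda>t. t * \<phi> t) c"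
    if c: "c \<in> gms_classes M" and AB: "A \<in> sets M" "B \<in> sets M" and \<phi>: "\<phi> \<in> borel_measurable Rpos" for c A B \<phi>
  proof -
    obtain g g' D where g: "has_gms_deriv M g g' D" "c = gms_rel M `` {g}" using c by (auto simp: gms_classes_def)
    have "(\<lambda>t::real. t) \<in> borel_measurable Rpos" by (rule measurable_Rpos_borel) simp
    then have m: "(\<lambda>t. t * \<phi> t) \<in> borel_measurable Rpos" using \<phi> by simp
    show ?thesis unfolding g(2) kappa_integral_def
      by (simp only: kappa_of_gms_class(3)[OF g(1) AB m] kappa_of_gms_class(4)[OF g(1) AB \<phi>] prod.case)
  qed
  show ?thesis
  proof (rule generated_topology_tests[where \<S> = "?S1 \<union> ?S2" and W = W])
    show "generate_topology_on (?S1 \<union> ?S2) W"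
      using W by (simp only: Gms_topology_def openin_topology_generated_by_iff)
    fix s c assume s: "s \<in> ?S1 \<union> ?S2" and cs: "c \<in> s" and c: "c \<in> gms_classes M"
    consider (1) A B U where "A \<in> sets M" "B \<in> sets M" "openin weak_topology_Rpos U" 
        "s = {c \<in> Gms M. kappa M c A B \<in> U}"
      | (2) A B U where "A \<in> sets M" "B \<in> sets M" "openin weak_topology_Rpos U" 
        "s = {c \<in> Gms M. times_t (kappa M c A B) \<in> U}" using s by blast
    then show "\<exists>F \<epsilon>. finite F \<and> F \<subseteq> kappa_tests M \<and> 0 < \<epsilon> \<and>
      (\<forall>c'\<in>gms_classes M. (\<forall>\<tau>\<in>F. \<bar>kappa_integral M \<tau> c' - kappa_integral M \<tau> c\<bar> < \<epsilon>) \<longrightarrow> c' \<in> s)"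
    proof cases
      case 1
      have "kappa M c A B \<in> U" using cs 1(4) by simp
      from weak_topology_tests[OF 1(3) this fin(1)[OF c 1(1,2)]] obtain F \<epsilon> where
        F: "finite F" "F \<subseteq> weak_tests" "0 < \<epsilon>" and U: "\<And>N'. N' \<in> finite_measures_Rpos \<Longrightarrow>
          (\<forall>\<phi>\<in>F. \<bar>(\<integral>t. \<phi> t \<partial>N') - (\<integral>t. \<phi> t \<partial>kappa M c A B)\<bar> < \<epsilon>) \<Longrightarrow> N' \<in> U" by auto
      let ?F = "(\<lambda>\<phi>. (A, B, \<phi>)) ` F"
      show ?thesis
      proof (intro exI conjI ballI impI)
        show "finite ?F" "0 < \<epsilon>" using F by auto
        show "?F \<subseteq> kappa_tests M"
        proof
          fix \<tau> assume "\<tau> \<in> ?F"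
          then obtain \<phi> where \<phi>: "\<phi> \<in> weak_tests" "\<tau> = (A, B, \<phi>)" using F by auto
          obtain K where K: "0 \<le> K" "\<And>t. 0 < t \<Longrightarrow> \<bar>\<phi> t\<bar> \<le> K" using weak_tests_bounded[OF \<phi>(1)] by auto
          have "\<bar>\<phi> t\<bar> \<le> K * (1 + t)" if "0 < t" for t
            using K(2)[OF that] mult_left_mono[of 1 "1 + t" K] K(1) that by linarith
          then show "\<tau> \<in> kappa_tests M" using 1 K(1) weak_tests_measurable[OF \<phi>(1)] \<phi>(2)
            by (auto simp: kappa_tests_def)
        qed
        fix c' assume c': "c' \<in> gms_classes M" 
          "\<forall>\<tau>\<in>?F. \<bar>kappa_integral M \<tau> c' - kappa_integral M \<tau> c\<bar> < \<epsilon>"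
        then have "kappa M c' A B \<in> U" 
          by (intro U fin 1) (auto simp: kappa_integral_def)
        then show "c' \<in> s" using Gms[OF c'(1)] 1(4) by simp
      qed
    next
      case 2
      have "times_t (kappa M c A B) \<in> U" using cs 2(4) by simp
      from weak_topology_tests[OF 2(3) this fin(2)[OF c 2(1,2)]] obtain F \<epsilon> where
        F: "finite F" "F \<subseteq> weak_tests" "0 < \<epsilon>" and U: "\<And>N'. N' \<in> finite_measures_Rpos \<Longrightarrow>
          (\<forall>\<phi>\<in>F. \<bar>(\<integral>t. \<phi> t \<partial>N') - (\<integral>t. \<phi> t \<partial>times_t (kappa M c A B))\<bar> < \<epsilon>) \<Longrightarrow> N' \<in> U" by auto
      let ?F = "(\<lambda>\<phi>. (A, B, \<lambda>t. t * \<phi> t)) ` F"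
      show ?thesis
      proof (intro exI conjI ballI impI)
        show "finite ?F" "0 < \<epsilon>" using F by auto
        show "?F \<subseteq> kappa_tests M"
        proof
          fix \<tau> assume "\<tau> \<in> ?F"
          then obtain \<phi> where \<phi>: "\<phi> \<in> weak_tests" "\<tau> = (A, B, \<lambda>t. t * \<phi> t)" using F by auto
          obtain K where K: "0 \<le> K" "\<And>t. 0 < t \<Longrightarrow> \<bar>\<phi> t\<bar> \<le> K" using weak_tests_bounded[OF \<phi>(1)] by auto
          have bound: "\<bar>t * \<phi> t\<bar> \<le> K * (1 + t)" if "0 < t" for t
          proof -
            have "\<bar>t * \<phi> t\<bar> = t * \<bar>\<phi> t\<bar>" using that by (simp add: abs_mult)
            also have "\<dots> \<le> t * K" using K(2)[OF that] that by (intro mult_left_mono) auto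
            also have "\<dots> \<le> K * (1 + t)" using K(1) by (simp add: algebra_simps)
            finally show ?thesis .
          qed
          have "(\<lambda>t::real. t) \<in> borel_measurable Rpos" by (rule measurable_Rpos_borel) simp
          then have "(\<lambda>t. t * \<phi> t) \<in> borel_measurable Rpos" using weak_tests_measurable[OF \<phi>(1)] by simp
          then show "\<tau> \<in> kappa_tests M" using 2 K(1) bound \<phi>(2) by (auto simp: kappa_tests_def)
        qed
        fix c' assume c': "c' \<in> gms_classes M" 
          "\<forall>\<tau>\<in>?F. \<bar>kappa_integral M \<tau> c' - kappa_integral M \<tau> c\<bar> < \<epsilon>"
        have "times_t (kappa M c' A B) \<in> U"
        proof (rule U[OF fin(2)[OF c'(1) 2(1,2)]], rule ballI)
          fix \<phi> assume \<phi>: "\<phi> \<in> F"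
          then have m: "\<phi> \<in> borel_measurable Rpos" using F(2) weak_tests_measurable by auto
          show "\<bar>(\<integral>t. \<phi> t \<partial>times_t (kappa M c' A B)) - (\<integral>t. \<phi> t \<partial>times_t (kappa M c A B))\<bar> < \<epsilon>"
            unfolding times[OF c'(1) 2(1,2) m] times[OF c 2(1,2) m] using c'(2) \<phi> by auto
        qed
        then show "c' \<in> s" using Gms[OF c'(1)] 2(4) by simp
      qed
    qed
  qed (use c in auto)
qed

lemma gms_classes_in_topspace:
  assumes "c \<in> gms_classes M"
  shows "c \<in> topspace (Gms_topology M)"
proof -
  obtain g g' D where g: "has_gms_deriv M g g' D" "c = gms_rel M `` {g}" using assms by (auto simp: gms_classes_def)
  have "openin weak_topology_Rpos {N \<in> finite_measures_Rpos. (\<integral>t. 0 \<partial>N) \<in> (UNIV :: real set)}"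
    unfolding weak_topology_Rpos_def
    by (rule topology_generated_by_Basis, rule CollectI, intro exI[of _ "\<lambda>_. 0"] exI[of _ UNIV])
      (auto simp: image_constant_conv)
  then have op: "openin weak_topology_Rpos finite_measures_Rpos" by simp
  have "c \<in> {c \<in> Gms M. kappa M c (space M) (space M) \<in> finite_measures_Rpos}"
    using kappa_of_gms_class(1)[OF g(1) sets.top sets.top] gms_rel_class(1) g by (auto simp: has_gms_deriv_def)
  moreover have "openin (Gms_topology M)
      {c \<in> Gms M. kappa M c (space M) (space M) \<in> finite_measures_Rpos}"
    unfolding Gms_topology_def
    by (rule topology_generated_by_Basis, rule UnI1, rule CollectI, rule exI[of _ "space M"],
        rule exI[of _ "space M"], rule exI[of _ finite_measures_Rpos], intro conjI refl sets.top op)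
  ultimately show ?thesis using openin_subset by blast
qed

section \<open>Closure of the double coset\<close>

text \<open>Outside \<open>E\<close> the two integrands differ by at most \<open>\<delta>\<close>, since \<open>A\<close> is tested at the same point \<open>x\<close>. On \<open>E\<close> they differ
by at most \<open>K (1 + h') + \<delta>\<close>. The estimate is in terms of the
\<open>h'\<mu>\<close>-measure of \<open>E\<close>: the summand \<open>1\<close> is at most
\<open>h'/s\<close> where \<open>h' \<ge> s\<close>, and the set where \<open>h' < s\<close> is accounted for separately.\<close>

lemma kappa_integral_close:
  assumes g: "has_gms_deriv M g g' D" and h: "has_gms_deriv M h h' Dh"
    and A: "A \<in> sets M" and B: "B \<in> sets M" and \<psi>: "\<psi> \<in> borel_measurable Rpos"
    and K: "0 \<le> K" "\<And>t. 0 < t \<Longrightarrow> \<bar>\<psi> t\<bar> \<le> K * (1 + t)"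
    and close: "AE x in M. \<bar>\<psi> (Dh x) - \<psi> (D x)\<bar> \<le> \<delta>"
    and E: "E \<in> sets M" "\<And>x. x \<in> space M \<Longrightarrow> x \<notin> E \<Longrightarrow> h x \<in> B \<longleftrightarrow> g x \<in> B"
    and s: "0 < s" and \<delta>: "0 \<le> \<delta>"
  shows "\<bar>kappa_integral M (A, B, \<psi>) (gms_rel M `` {h}) - kappa_integral M (A, B, \<psi>) (gms_rel M `` {g})\<bar>
    \<le> K * (measure M {x \<in> space M. Dh x < s} + (1 / s + 1) * (\<integral>x. indicat_real E x * Dh x \<partial>M)) + \<delta>"
proof -
  let ?S = "{x \<in> space M. Dh x < s}"
  note [measurable] = deriv_measurable(1)[OF g] deriv_measurable(1)[OF h] map_measurable[OF g] map_measurable[OF h] A B E(1)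
  have integ: "integrable M (\<lambda>x. indicat_real (A \<inter> f -` B) x * \<psi> (F x))" if f: "has_gms_deriv M f f' F" for f f' F
  proof (rule Bochner_Integration.integrable_bound[where f = "\<lambda>x. K * (1 + F x)"])
    show "integrable M (\<lambda>x. K * (1 + F x))" using deriv_integrable[OF f] by simp
    have "A \<inter> f -` B = A \<inter> (f -` B \<inter> space M)" using sets.sets_into_space[OF A] by auto
    then have "A \<inter> f -` B \<in> sets M" using A measurable_sets[OF map_measurable(1)[OF f] B] by simp
    then show "(\<lambda>x. indicat_real (A \<inter> f -` B) x * \<psi> (F x)) \<in> borel_measurable M"
      using measurable_compose[OF deriv_measurable(2)[OF f] \<psi>] by simp
    show "AE x in M. norm (indicat_real (A \<inter> f -` B) x * \<psi> (F x)) \<le> norm (K * (1 + F x))"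
    proof (rule AE_I2)
      fix x assume "x \<in> space M"
      then have "\<bar>\<psi> (F x)\<bar> \<le> K * (1 + F x)" using deriv_measurable(3)[OF f] K(2) by auto
      then show "norm (indicat_real (A \<inter> f -` B) x * \<psi> (F x)) \<le> norm (K * (1 + F x))"
        by (auto simp: indicator_def)
    qed
  qed
  note ih = integ[OF h] and ig = integ[OF g]
  have iE: "integrable M (\<lambda>x. indicat_real E x * Dh x)" 
    using integrable_mult_indicator[OF E(1) deriv_integrable[OF h]] by (simp only: real_scaleR_def)
  have S: "?S \<in> sets M" by measurable
  have iS: "integrable M (indicat_real ?S)" using S by (simp add: integrable_indicator_iff emeasure_eq_measure)
  have "\<bar>kappa_integral M (A, B, \<psi>) (gms_rel M `` {h}) - kappa_integral M (A, B, \<psi>) (gms_rel M `` {g})\<bar>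
    = \<bar>\<integral>x. indicat_real (A \<inter> h -` B) x * \<psi> (Dh x) - indicat_real (A \<inter> g -` B) x * \<psi> (D x) \<partial>M\<bar>"
    unfolding kappa_integral_def prod.case kappa_of_gms_class(3)[OF h A B \<psi>] kappa_of_gms_class(3)[OF g A B \<psi>]
    by (simp only: Bochner_Integration.integral_diff[OF ih ig])
  also have "\<dots> \<le> (\<integral>x. \<bar>indicat_real (A \<inter> h -` B) x * \<psi> (Dh x) - indicat_real (A \<inter> g -` B) x * \<psi> (D x)\<bar> \<partial>M)"
    by (rule integral_abs_bound)
  also have "\<dots> \<le> (\<integral>x. K * (indicat_real ?S x + (1 / s + 1) * (indicat_real E x * Dh x)) + \<delta> \<partial>M)"
  proof (rule integral_mono_AE)
    show "integrable M (\<lambda>x. \<bar>indicat_real (A \<inter> h -` B) x * \<psi> (Dh x) - indicat_real (A \<inter> g -` B) x * \<psi> (D x)\<bar>)"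
      using ih ig by (intro integrable_abs Bochner_Integration.integrable_diff)
    show "integrable M (\<lambda>x. K * (indicat_real ?S x + (1 / s + 1) * (indicat_real E x * Dh x)) + \<delta>)"
      using iE iS by (intro Bochner_Integration.integrable_add integrable_mult_right integrable_const)
    show "AE x in M. \<bar>indicat_real (A \<inter> h -` B) x * \<psi> (Dh x) - indicat_real (A \<inter> g -` B) x * \<psi> (D x)\<bar>
      \<le> K * (indicat_real ?S x + (1 / s + 1) * (indicat_real E x * Dh x)) + \<delta>"
      using close AE_space
    proof eventually_elim
      case (elim x)
      have Dh: "0 < Dh x" using deriv_measurable(3)[OF h] elim(2) by auto
      have \<psi>h: "\<bar>\<psi> (Dh x)\<bar> \<le> K * (1 + Dh x)" using K(2)[OF Dh] .
      show ?case
      proof (cases "x \<in> E")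
        case True
        have "1 + Dh x \<le> indicat_real ?S x + (1 / s + 1) * Dh x"
        proof (cases "Dh x < s")
          case False
          then have "1 \<le> (1 / s) * Dh x" using s by (simp add: field_simps)
          then show ?thesis using False elim(2) by (simp add: distrib_right)
        qed (use Dh s elim(2) in \<open>simp add: distrib_right\<close>)
        then have "K * (1 + Dh x) \<le> K * (indicat_real ?S x + (1 / s + 1) * (indicat_real E x * Dh x))"
          using True K(1) by (intro mult_left_mono) auto
        moreover have "\<bar>indicat_real (A \<inter> h -` B) x * \<psi> (Dh x) - indicat_real (A \<inter> g -` B) x * \<psi> (D x)\<bar>
          \<le> \<bar>\<psi> (Dh x)\<bar> + \<delta>" using elim(1) \<delta> by (auto simp: indicator_def abs_if split: if_splits)
        ultimately show ?thesis using \<psi>h by linarith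
      next
        case False
        then have "indicat_real (A \<inter> h -` B) x = indicat_real (A \<inter> g -` B) x"
          using E(2)[OF elim(2)] by (auto simp: indicator_def)
        then have "\<bar>indicat_real (A \<inter> h -` B) x * \<psi> (Dh x) - indicat_real (A \<inter> g -` B) x * \<psi> (D x)\<bar> \<le> \<delta>"
          using elim(1) \<delta> by (auto simp: indicator_def)
        moreover have "0 \<le> K * (indicat_real ?S x + (1 / s + 1) * (indicat_real E x * Dh x))"
          using K(1) s Dh by (intro mult_nonneg_nonneg add_nonneg_nonneg) auto
        ultimately show ?thesis by linarith
      qed
    qed
  qed
  also have "\<dots> = K * (measure M ?S + (1 / s + 1) * (\<integral>x. indicat_real E x * Dh x \<partial>M)) + \<delta>"
    using iE iS S by (simp add: Bochner_Integration.integral_add prob_space)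
  finally show ?thesis .
qed

text \<open>An element with the right law of the derivative cannot be separated from the double coset of \<open>L\<close> by
finitely many tests. The number \<open>s\<close> has to be fixed first: it depends only on the law. Then \<open>\<delta>\<close> is chosen in
terms of \<open>s\<close> and of the number \<open>m\<close> of cells.\<close>

lemma double_coset_meets_tests:
  fixes L :: "'b measure"
  assumes std: "measure_preserving_iso M (completion uniform01) w w'"
    and g: "has_gms_deriv M g g' D"
    and t: "t \<in> measurable L Rpos"
    and L: "measure_preserving_iso L (completion uniform01) k k'"
    and Ls: "measure_preserving_iso (density L (\<lambda>z. ennreal (t z))) (completion uniform01) q q'"
    and law: "distr L Rpos t = distr M Rpos D"
    and F: "finite F" "F \<subseteq> kappa_tests M" and "0 < \<epsilon>"
  shows "\<exists>a a' b b'. measure_preserving_iso M L a a' \<and>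
    measure_preserving_iso M (density L (\<lambda>z. ennreal (t z))) b b' \<and>
    (\<forall>\<tau>\<in>F. \<bar>kappa_integral M \<tau> (gms_rel M `` {b' \<circ> a}) - kappa_integral M \<tau> (gms_rel M `` {g})\<bar> < \<epsilon>)"
proof -
  have "\<forall>\<tau>\<in>F. \<exists>K\<ge>0. \<forall>t>0. \<bar>snd (snd \<tau>) t\<bar> \<le> K * (1 + t)" using F(2) by (auto simp: kappa_tests_def)
  then obtain Kf where Kf: "\<And>\<tau>. \<tau> \<in> F \<Longrightarrow> 0 \<le> Kf \<tau>" 
    "\<And>\<tau> t. \<tau> \<in> F \<Longrightarrow> 0 < t \<Longrightarrow> \<bar>snd (snd \<tau>) t\<bar> \<le> Kf \<tau> * (1 + t)" by metis
  define K where "K = sum Kf F"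
  have K0: "0 \<le> K" unfolding K_def by (rule sum_nonneg) (rule Kf(1))
  have K: "\<bar>\<psi> t\<bar> \<le> K * (1 + t)" if "(A, B, \<psi>) \<in> F" "0 < t" for A B \<psi> t
  proof -
    have "Kf (A, B, \<psi>) \<le> K" unfolding K_def using that F(1) Kf(1) by (intro member_le_sum) auto
    then have "Kf (A, B, \<psi>) * (1 + t) \<le> K * (1 + t)" using that by (intro mult_right_mono) auto
    then show ?thesis using Kf(2)[OF that] by simp
  qed
  have Dm: "D \<in> measurable M Rpos" by (rule deriv_measurable(2)[OF g])
  define \<eta> where "\<eta> = \<epsilon> / (4 * (K + 1))"
  have \<eta>: "0 < \<eta>" "K * \<eta> \<le> \<epsilon> / 4" using K0 \<open>0 < \<epsilon>\<close> by (auto simp: \<eta>_def field_simps)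
  have "finite_measure (distr M Rpos D)" using prob_space_distr[OF Dm] by (rule prob_space.finite_measure)
  from small_mass_near_zero[OF this _ \<eta>(1)] obtain s where s: "0 < s" "measure (distr M Rpos D) {0<..<s} < \<eta>"
    by auto
  have "finite ((\<lambda>\<tau>. fst (snd \<tau>)) ` F)" "(\<lambda>\<tau>. fst (snd \<tau>)) ` F \<subseteq> sets M"
    using F by (auto simp: kappa_tests_def)
  from finite_sets_index[OF this] obtain \<iota> :: "'a \<Rightarrow> nat" and m where
    \<iota>: "\<iota> \<in> measurable M (count_space UNIV)" "\<And>y. \<iota> y < m"
    and \<iota>B: "\<And>y y'. \<iota> y = \<iota> y' \<Longrightarrow> (\<forall>B\<in>(\<lambda>\<tau>. fst (snd \<tau>)) ` F. y \<in> B \<longleftrightarrow> y' \<in> B)" by auto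
  \<comment> \<open>\<open>C \<delta>\<close> bounds the contribution of the set where \<open>h\<close> and \<open>g\<close> hit different cells.\<close>
  define C where "C = K * ((1 / s + 1) * real m)"
  have C0: "0 \<le> C" using K0 s(1) by (auto simp: C_def)
  define \<delta> where "\<delta> = \<epsilon> / (2 * (C + 1))"
  have \<delta>: "0 < \<delta>" "C * \<delta> + \<delta> = \<epsilon> / 2" using C0 \<open>0 < \<epsilon>\<close> 
    by (auto simp: \<delta>_def divide_simps) (simp add: algebra_simps)
  define \<Psi> where "\<Psi> = insert (\<lambda>t. t) ((\<lambda>\<tau>. snd (snd \<tau>)) ` F)"
  have "finite \<Psi>" "\<Psi> \<subseteq> borel_measurable Rpos"
    using F by (auto simp: \<Psi>_def kappa_tests_def intro: measurable_Rpos_borel)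
  from finite_functions_index[OF this \<delta>(1)] obtain \<kappa> :: "real \<Rightarrow> nat" where
    \<kappa>: "\<kappa> \<in> measurable Rpos (count_space UNIV)" "\<And>r s. \<kappa> r = \<kappa> s \<Longrightarrow> (\<forall>\<psi>\<in>\<Psi>. \<bar>\<psi> r - \<psi> s\<bar> \<le> \<delta>)" by auto
  have \<kappa>id: "\<And>r s. \<kappa> r = \<kappa> s \<Longrightarrow> \<bar>r - s\<bar> \<le> \<delta>" using \<kappa>(2) by (auto simp: \<Psi>_def)
  obtain a a' b b' where a: "measure_preserving_iso M L a a'"
    and b: "measure_preserving_iso M (density L (\<lambda>z. ennreal (t z))) b b'"
    and \<kappa>eq: "AE x in M. \<kappa> (t (a x)) = \<kappa> (D x)"
    and mass: "(\<integral>x. indicat_real {x \<in> space M. \<iota> (b' (a x)) \<noteq> \<iota> (g x)} x * t (a x) \<partial>M) \<le> real m * \<delta>"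
    by (rule approximating_coset_element[OF std g t L Ls law \<kappa>(1) \<kappa>id \<iota>]) 
  have h: "has_gms_deriv M (b' \<circ> a) (a' \<circ> b) (\<lambda>x. t (a x))" by (rule coset_has_gms_deriv[OF a b t])
  let ?E = "{x \<in> space M. \<iota> (b' (a x)) \<noteq> \<iota> (g x)}"
  have E: "?E \<in> sets M"
    using measurable_compose[OF map_measurable(1)[OF h] \<iota>(1)] measurable_compose[OF map_measurable(1)[OF g] \<iota>(1)]
    by (intro sets_index_neq) simp_all
  have small: "measure M {x \<in> space M. t (a x) < s} < \<eta>"
  proof -
    have "distr M Rpos (\<lambda>x. t (a x)) = distr (distr M L a) Rpos t"
      using distr_distr[OF t mp_iso_facts(1)[OF a]] by (simp add: comp_def)
    then have "distr M Rpos (\<lambda>x. t (a x)) = distr M Rpos D" by (simp only: mp_iso_distr[OF a] law)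
    moreover have "{x \<in> space M. t (a x) < s} = (\<lambda>x. t (a x)) -` {0<..<s} \<inter> space M"
      using deriv_measurable(3)[OF h] by auto
    ultimately show ?thesis using s(2) measure_distr[OF deriv_measurable(2)[OF h], of "{0<..<s}"]
      by (simp add: sets_Rpos_iff greaterThanLessThan_def)
  qed
  have "\<bar>kappa_integral M \<tau> (gms_rel M `` {b' \<circ> a}) - kappa_integral M \<tau> (gms_rel M `` {g})\<bar> < \<epsilon>" if \<tau>: "\<tau> \<in> F" for \<tau>
  proof -
    obtain A B \<psi> where \<tau>_eq: "\<tau> = (A, B, \<psi>)" by (cases \<tau>) auto
    have AB: "A \<in> sets M" "B \<in> sets M" "\<psi> \<in> borel_measurable Rpos" using \<tau> F(2) by (auto simp: \<tau>_eq kappa_tests_def)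
    have \<psi>: "\<psi> \<in> \<Psi>" using \<tau> \<tau>_eq unfolding \<Psi>_def by force
    have B: "B \<in> (\<lambda>\<tau>. fst (snd \<tau>)) ` F" using \<tau> \<tau>_eq by force
    have close: "AE x in M. \<bar>\<psi> (t (a x)) - \<psi> (D x)\<bar> \<le> \<delta>"
      using \<kappa>eq by eventually_elim (use \<kappa>(2) \<psi> in blast)
    have "\<bar>kappa_integral M \<tau> (gms_rel M `` {b' \<circ> a}) - kappa_integral M \<tau> (gms_rel M `` {g})\<bar> \<le>
       K * (measure M {x \<in> space M. t (a x) < s} + (1 / s + 1) * (\<integral>x. indicat_real ?E x * t (a x) \<partial>M)) + \<delta>"
      unfolding \<tau>_eq
    proof (rule kappa_integral_close[OF g h AB K0 _ close E _ s(1) less_imp_le[OF \<delta>(1)]])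
      show "\<bar>\<psi> t\<bar> \<le> K * (1 + t)" if "0 < t" for t using K[of A B \<psi> t] \<tau> that by (simp add: \<tau>_eq)
      fix x assume "x \<in> space M" "x \<notin> ?E"
      then have "\<iota> (b' (a x)) = \<iota> (g x)" by simp
      then show "(b' \<circ> a) x \<in> B \<longleftrightarrow> g x \<in> B" using \<iota>B B by (metis comp_apply)
    qed
    also have "\<dots> \<le> K * (\<eta> + (1 / s + 1) * (real m * \<delta>)) + \<delta>"
      using small mass K0 s(1) by (intro add_right_mono mult_left_mono add_mono) auto
    also have "\<dots> = K * \<eta> + (C * \<delta> + \<delta>)" by (simp add: C_def algebra_simps)
    also have "\<dots> < \<epsilon>" unfolding \<delta>(2) using \<eta>(2) \<open>0 < \<epsilon>\<close> by linarith
    finally show ?thesis .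
  qed
  with a b show ?thesis by blast
qed

end

theorem theorem1p5:
  fixes M :: "'a measure"
    and \<nu> \<nu>_c \<nu>_d \<nu>_inf_c :: "real measure"
    and \<nu>s :: "nat \<Rightarrow> real measure"
  assumes "lebesgue_space M" and "nonatomic M"
    and "sets \<nu> = sets Rpos"
    and "emeasure \<nu> (space \<nu>) = 1"
    and "(\<integral>\<^sup>+t. ennreal t \<partial>\<nu>) = 1"
    and "sets \<nu>_c = sets Rpos" and "nonatomic \<nu>_c"
    and "sets \<nu>_d = sets Rpos" and "discrete_measure \<nu>_d"
    and "\<nu> = add_measure \<nu>_c \<nu>_d"
    and "sets \<nu>_inf_c = sets Rpos" and "nonatomic \<nu>_inf_c"
    and "admissible \<nu>s (add_measure \<nu>_inf_c \<nu>_d)"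
    and "total_measure \<nu>s \<nu>_inf_c = \<nu>_c"
  shows "double_coset M \<nu>s (add_measure \<nu>_inf_c \<nu>_d)
    \<subseteq> Gms_topology M closure_of
        double_coset M (\<lambda>j. if j = 0 then \<nu>_c else null_measure Rpos) \<nu>_d"
proof -
  let ?inf = "add_measure \<nu>_inf_c \<nu>_d"
  interpret prob_space M using assms(1) by (simp add: lebesgue_space_def)
  obtain w w' where std: "measure_preserving_iso M (completion uniform01) w w'"
    by (rule lebesgue_space_iso_uniform01[OF assms(1,2)])
  have s\<nu>s: "\<And>j. sets (\<nu>s j) = sets Rpos" and sinf: "sets ?inf = sets Rpos"
    using assms(13) by (auto simp: admissible_def)
  have s1: "\<And>j. sets (single_sheet \<nu>_c j) = sets Rpos" using assms(6) by (simp add: single_sheet_def)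
  have e\<nu>: "emeasure \<nu> E = emeasure \<nu>_c E + emeasure \<nu>_d E" if "E \<in> sets Rpos" for E
    using emeasure_add_measure[of \<nu>_d \<nu>_c E] assms(6,8,10) that by simp
  have law1: "total_measure (single_sheet \<nu>_c) \<nu>_d = \<nu>"
  proof (rule measure_eqI)
    fix E assume "E \<in> sets (total_measure (single_sheet \<nu>_c) \<nu>_d)"
    then have E: "E \<in> sets Rpos" by (simp add: sets_total_measure)
    have "(\<Sum>j. emeasure (single_sheet \<nu>_c j) E) = (\<Sum>j\<in>{0}. emeasure (single_sheet \<nu>_c j) E)"
      by (rule suminf_finite) (auto simp: single_sheet_def)
    then show "emeasure (total_measure (single_sheet \<nu>_c) \<nu>_d) E = emeasure \<nu> E"
      by (simp add: emeasure_total_measure[OF s1 assms(8) E] e\<nu>[OF E]) (simp add: single_sheet_def)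
  qed (simp add: sets_total_measure assms(3))
  have law2: "total_measure \<nu>s ?inf = \<nu>"
  proof (rule measure_eqI)
    fix E assume "E \<in> sets (total_measure \<nu>s ?inf)"
    then have E: "E \<in> sets Rpos" by (simp add: sets_total_measure)
    have "emeasure \<nu>_c E = (\<Sum>j. emeasure (\<nu>s j) E) + emeasure \<nu>_inf_c E"
      using emeasure_total_measure[where \<nu> = \<nu>s, OF s\<nu>s assms(11) E] assms(14) by simp
    then show "emeasure (total_measure \<nu>s ?inf) E = emeasure \<nu> E"
      using emeasure_add_measure[of \<nu>_d \<nu>_inf_c E] assms(8,11) E
      by (simp add: emeasure_total_measure[where \<nu> = \<nu>s, OF s\<nu>s sinf E] e\<nu>[OF E] add.assoc)
  qed (simp add: sets_total_measure assms(3))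
  let ?L = "L_space (single_sheet \<nu>_c) \<nu>_d"
  have tL: "t_coord \<in> measurable ?L Rpos" 
    unfolding L_space_eq by (rule measurable_completion[OF measurable_t_coord[OF s1 assms(8)]])
  have dL: "distr ?L Rpos t_coord = \<nu>"
    unfolding L_space_eq distr_completion[OF measurable_t_coord[OF s1 assms(8)]] distr_t_coord[OF s1 assms(8)] by (rule law1)
  obtain k k' where L: "measure_preserving_iso ?L (completion uniform01) k k'"
    using single_sheet_iso_uniform01(1)[OF assms(6-9) law1 assms(4,5)] by auto
  obtain q q' where "measure_preserving_iso (L_star_space (single_sheet \<nu>_c) \<nu>_d) (completion uniform01) q q'"
    using single_sheet_iso_uniform01(2)[OF assms(6-9) law1 assms(4,5)] by auto
  then have Ls: "measure_preserving_iso (density ?L (\<lambda>z. ennreal (t_coord z))) (completion uniform01) q q'"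
    by (simp only: L_star_space_def)
  show ?thesis unfolding single_sheet_def[symmetric]
  proof
    fix c assume "c \<in> double_coset M \<nu>s ?inf"
    then obtain a a' b b' where c: "c = gms_rel M `` {b' \<circ> a}"
      and a: "measure_preserving_iso M (L_space \<nu>s ?inf) a a'"
      and b: "measure_preserving_iso M (L_star_space \<nu>s ?inf) b b'"
      by (auto simp: double_coset_def)
    have t: "t_coord \<in> measurable (L_space \<nu>s ?inf) Rpos"
      unfolding L_space_eq by (rule measurable_completion[OF measurable_t_coord[OF s\<nu>s sinf]])
    have g: "has_gms_deriv M (b' \<circ> a) (a' \<circ> b) (\<lambda>x. t_coord (a x))"
      by (rule coset_has_gms_deriv[OF a _ t]) (use b in \<open>simp add: L_star_space_def\<close>)
    have "distr M Rpos (\<lambda>x. t_coord (a x)) = distr (distr M (L_space \<nu>s ?inf) a) Rpos t_coord"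
      using distr_distr[OF t mp_iso_facts(1)[OF a]] by (simp add: comp_def)
    also have "\<dots> = distr (L_borel \<nu>s ?inf) Rpos t_coord"
      unfolding mp_iso_distr[OF a] unfolding L_space_eq by (rule distr_completion[OF measurable_t_coord[OF s\<nu>s sinf]])
    also have "\<dots> = \<nu>" unfolding distr_t_coord[OF s\<nu>s sinf] by (rule law2)
    finally have law: "distr ?L Rpos t_coord = distr M Rpos (\<lambda>x. t_coord (a x))" by (simp add: dL)
    have cC: "c \<in> gms_classes M" using g c by (auto simp: gms_classes_def)
    show "c \<in> Gms_topology M closure_of double_coset M (single_sheet \<nu>_c) \<nu>_d"
      unfolding in_closure_of
    proof (intro conjI allI impI)
      show "c \<in> topspace (Gms_topology M)" by (rule gms_classes_in_topspace[OF cC])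
      fix W assume W: "c \<in> W \<and> openin (Gms_topology M) W"
      then obtain F \<epsilon> where F: "finite F" "F \<subseteq> kappa_tests M" "0 < \<epsilon>"
        and FW: "\<And>c'. c' \<in> gms_classes M \<Longrightarrow>
          (\<forall>\<tau>\<in>F. \<bar>kappa_integral M \<tau> c' - kappa_integral M \<tau> c\<bar> < \<epsilon>) \<Longrightarrow> c' \<in> W"
        using Gms_topology_tests[of W c] cC by auto
      obtain p p' r r' where p: "measure_preserving_iso M ?L p p'"
        and r: "measure_preserving_iso M (density ?L (\<lambda>z. ennreal (t_coord z))) r r'"
        and close: "\<forall>\<tau>\<in>F. \<bar>kappa_integral M \<tau> (gms_rel M `` {r' \<circ> p}) - kappa_integral M \<tau> c\<bar> < \<epsilon>"
        using double_coset_meets_tests[OF std g tL L Ls law F] unfolding c by blast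
      have "gms_rel M `` {r' \<circ> p} \<in> gms_classes M"
        using coset_has_gms_deriv[OF p r tL] by (auto simp: gms_classes_def)
      then have "gms_rel M `` {r' \<circ> p} \<in> W" using close by (rule FW)
      moreover have "gms_rel M `` {r' \<circ> p} \<in> double_coset M (single_sheet \<nu>_c) \<nu>_d"
      proof -
        have "gms_rel M `` {r' \<circ> p} = gms_rel M `` {r' \<circ> id \<circ> p}" by simp
        then show ?thesis using p r unfolding double_coset_def L_star_space_def by blast
      qed
      ultimately show "\<exists>y. y \<in> double_coset M (single_sheet \<nu>_c) \<nu>_d \<and> y \<in> W" by blast
    qed
  qed
qed

end
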